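(* There exists a nuclear Fréchet space $E$ with the properties $\underline{DN}$ and $\Omega$ satisfying $\Delta(E)=\Delta(\Lambda_{1}(\varepsilon))$ for its associated exponent sequence $\varepsilon$ such that there is no prominent bounded set of $E$.
   Context: **Diameters.** For absolutely convex sets $U,V$ in a Fréchet space $E$ with $V\subseteq CU$ for some $C>0$, the $n$-th Kolmogorov diameter ($n=0,1,2,\dots$) is $d_n(V,U)=\inf\{t>0:\ V\subseteq tU+L \text{ for some linear subspace } L\subseteq E,\ \dim L\le n\}$. **Diametral dimension.** Let $(\|\cdot\|_k)_{k\ge1}$ be an increasing fundamental sequence of seminorms of $E$ and $U_k=\{x\in E:\|x\|_k\le1\}$. The diametral dimension is $$\Delta(E)=\{(t_n)_{n\ge 0}:\ \forall p\ \exists q>p\ \lim_{n\to\infty}t_n d_n(U_q,U_p)=0\}$$ (a set of scalar sequences, independent of the choice of seminorms). **Prominent bounded set.** A bounded set $B\subseteq E$ is prominent if $\Delta(E)=\{(x_n)_{n\ge0}:\lim_{n\to\infty}x_nd_n(B,U_p)=0\ \ \forall p\}$. **Property $\underline{DN}$:** $\exists k\ \forall j\ \exists l,\ C>0,\ 0<\lambda<1$ with $\|x\|_j\le C\|x\|_k^{\lambda}\|x\|_l^{1-\lambda}$ for all $x\in E$. **Property $\Omega$:** $\forall p\ \exists q\ \forall k\ \exists C>0,\ 0<\theta<1$ with $\|y\|_q^*\le C(\|y\|_p^* )^{1-\theta}(\|y\|_k^* )^{\theta}$ for all $y\in E'$, where $\|y\|_k^*=\sup\{|y(x)|:\|x\|_k\le1\}\in[0,+\infty]$.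 **Power series spaces.** An exponent sequence is a non-negative increasing sequence $\alpha=(\alpha_n)_{n\ge0}$ with $\alpha_n\to+\infty$. Then $\Lambda_1(\alpha)=\{x=(x_n)_{n\ge 0}:\|x\|_k=\sum_n|x_n|e^{-\alpha_n/k}<\infty\ \forall k\ge1\}$ and $\Lambda_\infty(\alpha)=\{x:\|x\|_k=\sum_n|x_n|e^{k\alpha_n}<\infty\ \forall k\ge1\}$, with the Fréchet topologies given by these norms. The dual $\Lambda_\infty(\alpha)'$ is identified with the sequence space $\{(t_n):\exists k\ \sup_n|t_n|e^{-k\alpha_n}<\infty\}$. **Associated exponent sequence.** For a nuclear Fréchet space $E$ with $\underline{DN}$ and $\Omega$ there is (known fact) an exponent sequence $\varepsilon=(\varepsilon_n)_{n\ge0}$, unique up to equivalence (each of two equivalent sequences is bounded by a constant multiple of the other, up to finitely many terms), such that $\Delta(\Lambda_1(\varepsilon))\subseteq\Delta(E)\subseteq\Delta(\Lambda_\infty(\varepsilon))$ and, for every exponent sequence $\alpha$: $\Lambda_1(\alpha)\subseteq\Delta(E)$ implies $\Lambda_1(\alpha)\subseteq\Lambda_1(\varepsilon)$, and $\Delta(E)\subseteq\Lambda_\infty(\alpha)'$ implies $\Lambda_\infty(\varepsilon)'\subseteq\Lambda_\infty(\alpha)'$. This $\varepsilon$ is called the associated exponent sequence of $E$. *)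

theory Defs
  imports "HOL-Analysis.Analysis" "HOL-Library.Function_Algebras"
begin

text \<open>
  A graded Frechet space over a scalar field \<open>'k\<close> is given by a scalar multiplication
  \<open>s\<close> on an ambient vector space \<open>'a\<close>, a linear subspace \<open>E\<close> of \<open>'a\<close> as carrier, and an increasing
  fundamental sequence of seminorms \<open>nrm\<close> on \<open>E\<close>, which defines the topology of \<open>E\<close>; this topology
  is unrelated to any topology on the type \<open>'a\<close>. Seminorms are numbered from 0, so
  \<open>nrm k\<close> is the seminorm usually written with index \<open>k + 1\<close>.
\<close>

definition seminorm_on ::
  "('k::real_normed_field \<Rightarrow> 'a::ab_group_add \<Rightarrow> 'a) \<Rightarrow> 'a set \<Rightarrow> ('a \<Rightarrow> real) \<Rightarrow> bool" where
  "seminorm_on s E p \<longleftrightarrow>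
     (\<forall>x\<in>E. 0 \<le> p x) \<and>
     (\<forall>c. \<forall>x\<in>E. p (s c x) = norm c * p x) \<and>
     (\<forall>x\<in>E. \<forall>y\<in>E. p (x + y) \<le> p x + p y)"

text \<open>
  Completeness is sequential, which is the same as completeness since the topology is metrizable.
\<close>

definition frechet_space ::
  "('k::real_normed_field \<Rightarrow> 'a::ab_group_add \<Rightarrow> 'a) \<Rightarrow> 'a set \<Rightarrow> (nat \<Rightarrow> 'a \<Rightarrow> real) \<Rightarrow> bool" where
  "frechet_space s E nrm \<longleftrightarrow>
     vector_space s \<and> module.subspace s E \<and>
     (\<forall>k. seminorm_on s E (nrm k)) \<and>
     (\<forall>k. \<forall>x\<in>E. nrm k x \<le> nrm (Suc k) x) \<and>
     (\<forall>x\<in>E. (\<forall>k. nrm k x = 0) \<longrightarrow> x = 0) \<and>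
     (\<forall>X. (\<forall>n. X n \<in> E) \<and>
          (\<forall>k. \<forall>e>0. \<exists>M. \<forall>m\<ge>M. \<forall>n\<ge>M. nrm k (X m - X n) < e) \<longrightarrow>
          (\<exists>x\<in>E. \<forall>k. (\<lambda>n. nrm k (X n - x)) \<longlonglongrightarrow> 0))"

definition unit_ball :: "'a set \<Rightarrow> ('a \<Rightarrow> real) \<Rightarrow> 'a set" where
  "unit_ball E p = {x \<in> E. p x \<le> 1}"

definition bounded_set :: "'a set \<Rightarrow> (nat \<Rightarrow> 'a \<Rightarrow> real) \<Rightarrow> 'a set \<Rightarrow> bool" where
  "bounded_set E nrm B \<longleftrightarrow> B \<subseteq> E \<and> (\<forall>k. bdd_above (nrm k ` B))"

definition linear_functional_on ::
  "('k::real_normed_field \<Rightarrow> 'a::ab_group_add \<Rightarrow> 'a) \<Rightarrow> 'a set \<Rightarrow> ('a \<Rightarrow> 'k) \<Rightarrow> bool" where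
  "linear_functional_on s E y \<longleftrightarrow>
     (\<forall>u\<in>E. \<forall>v\<in>E. y (u + v) = y u + y v) \<and> (\<forall>c. \<forall>u\<in>E. y (s c u) = c * y u)"

definition dual_norm ::
  "'a set \<Rightarrow> ('a \<Rightarrow> real) \<Rightarrow> ('a \<Rightarrow> 'k::real_normed_field) \<Rightarrow> ennreal" where
  "dual_norm E p y = (SUP x\<in>unit_ball E p. ennreal (norm (y x)))"

text \<open>Functionals are total functions on \<open>'a\<close>; only their values on \<open>E\<close> matter.\<close>

definition topological_dual ::
  "('k::real_normed_field \<Rightarrow> 'a::ab_group_add \<Rightarrow> 'a) \<Rightarrow> 'a set \<Rightarrow> (nat \<Rightarrow> 'a \<Rightarrow> real) \<Rightarrow> ('a \<Rightarrow> 'k) set" where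
  "topological_dual s E nrm =
     {y. linear_functional_on s E y \<and> (\<exists>k C. \<forall>x\<in>E. norm (y x) \<le> C * nrm k x)}"

text \<open>
  For seminorms \<open>p \<le> q\<close>, the canonical map from the local Banach space \<open>E\<^sub>q\<close> to the local Banach
  space \<open>E\<^sub>p\<close> is nuclear, written out on the dense image of \<open>E\<close>. A continuous functional on
  \<open>E\<^sub>q\<close> is a linear functional on \<open>E\<close> with finite \<open>q\<close>-dual norm. The vectors \<open>z i\<close> are taken in \<open>E\<close>
  and not in the completion \<open>E\<^sub>p\<close>; by density every nuclear map has such a representation.
\<close>

definition canonical_map_nuclear ::
  "('k::real_normed_field \<Rightarrow> 'a::ab_group_add \<Rightarrow> 'a) \<Rightarrow> 'a set \<Rightarrow> ('a \<Rightarrow> real) \<Rightarrow> ('a \<Rightarrow> real) \<Rightarrow> bool" where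
  "canonical_map_nuclear s E q p \<longleftrightarrow>
     (\<exists>(y :: nat \<Rightarrow> 'a \<Rightarrow> 'k) (z :: nat \<Rightarrow> 'a).
        (\<forall>i. linear_functional_on s E (y i) \<and> dual_norm E q (y i) < top \<and> z i \<in> E) \<and>
        (\<Sum>i. dual_norm E q (y i) * ennreal (p (z i))) < top \<and>
        (\<forall>x\<in>E. (\<lambda>N. p (x - (\<Sum>i<N. s (y i x) (z i)))) \<longlonglongrightarrow> 0))"

definition nuclear_space ::
  "('k::real_normed_field \<Rightarrow> 'a::ab_group_add \<Rightarrow> 'a) \<Rightarrow> 'a set \<Rightarrow> (nat \<Rightarrow> 'a \<Rightarrow> real) \<Rightarrow> bool" where
  "nuclear_space s E nrm \<longleftrightarrow> (\<forall>p. \<exists>q\<ge>p. canonical_map_nuclear s E (nrm q) (nrm p))"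

text \<open>
  The linear subspaces of \<open>E\<close> of dimension at most \<open>n\<close> are the spans of at most \<open>n\<close> vectors of \<open>E\<close>.
  (The library's \<open>dim\<close> is 0 on infinite-dimensional spaces.)
\<close>

definition kolmogorov_diameter ::
  "('k::real_normed_field \<Rightarrow> 'a::ab_group_add \<Rightarrow> 'a) \<Rightarrow> 'a set \<Rightarrow> nat \<Rightarrow> 'a set \<Rightarrow> 'a set \<Rightarrow> real" where
  "kolmogorov_diameter s E n V U =
     Inf {t. 0 < t \<and>
             (\<exists>B. finite B \<and> card B \<le> n \<and> B \<subseteq> E \<and>
                  V \<subseteq> {s (of_real t) u + l | u l. u \<in> U \<and> l \<in> module.span s B})}"

definition diametral_dimension ::
  "('k::real_normed_field \<Rightarrow> 'a::ab_group_add \<Rightarrow> 'a) \<Rightarrow> 'a set \<Rightarrow> (nat \<Rightarrow> 'a \<Rightarrow> real) \<Rightarrow> (nat \<Rightarrow> 'k) set" where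
  "diametral_dimension s E nrm =
     {t. \<forall>p. \<exists>q>p.
        (\<lambda>n. t n * of_real (kolmogorov_diameter s E n (unit_ball E (nrm q)) (unit_ball E (nrm p))))
          \<longlonglongrightarrow> 0}"

definition prominent_bounded_set ::
  "('k::real_normed_field \<Rightarrow> 'a::ab_group_add \<Rightarrow> 'a) \<Rightarrow> 'a set \<Rightarrow> (nat \<Rightarrow> 'a \<Rightarrow> real) \<Rightarrow> 'a set \<Rightarrow> bool" where
  "prominent_bounded_set s E nrm B \<longleftrightarrow>
     bounded_set E nrm B \<and>
     diametral_dimension s E nrm =
       {x. \<forall>p. (\<lambda>n. x n * of_real (kolmogorov_diameter s E n B (unit_ball E (nrm p)))) \<longlonglongrightarrow> 0}"

definition DN_property :: "'a set \<Rightarrow> (nat \<Rightarrow> 'a \<Rightarrow> real) \<Rightarrow> bool" where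
  "DN_property E nrm \<longleftrightarrow>
     (\<exists>k. \<forall>j. \<exists>l. \<exists>C>0. \<exists>lam. 0 < lam \<and> lam < 1 \<and>
        (\<forall>x\<in>E. nrm j x \<le> C * nrm k x powr lam * nrm l x powr (1 - lam)))"

definition ennreal_rpow :: "ennreal \<Rightarrow> real \<Rightarrow> ennreal" where
  "ennreal_rpow x a = (if x = top then top else ennreal (enn2real x powr a))"

text \<open>
  \<open>ennreal_rpow\<close> is only used with positive exponents. The indeterminate product of 0 and infinity
  does not occur below, because a functional with some dual norm equal to 0 vanishes on \<open>E\<close>.
\<close>

definition Omega_property ::
  "('k::real_normed_field \<Rightarrow> 'a::ab_group_add \<Rightarrow> 'a) \<Rightarrow> 'a set \<Rightarrow> (nat \<Rightarrow> 'a \<Rightarrow> real) \<Rightarrow> bool" where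
  "Omega_property s E nrm \<longleftrightarrow>
     (\<forall>p. \<exists>q. \<forall>k. \<exists>C>0. \<exists>\<theta>. 0 < \<theta> \<and> \<theta> < 1 \<and>
        (\<forall>y\<in>topological_dual s E nrm.
           dual_norm E (nrm q) y \<le>
             ennreal C * ennreal_rpow (dual_norm E (nrm p) y) (1 - \<theta>)
                       * ennreal_rpow (dual_norm E (nrm k) y) \<theta>))"

definition exponent_sequence :: "(nat \<Rightarrow> real) \<Rightarrow> bool" where
  "exponent_sequence \<alpha> \<longleftrightarrow> (\<forall>n. 0 \<le> \<alpha> n) \<and> mono \<alpha> \<and> filterlim \<alpha> at_top sequentially"

text \<open>
  Scalar multiplication on the space of all sequences. Every nuclear Frechet space is separable, so
  it has at most the cardinality of the continuum and is, as a vector space, isomorphic to a linear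
  subspace of the space of sequences. Hence a linear subspace of that space with arbitrary
  seminorms is no restriction on a nuclear Frechet space. The scalar types of class \<open>real_normed_field\<close> and
  \<open>euclidean_space\<close> are, up to isomorphism, the real and the complex numbers.
\<close>

definition seq_scale :: "'k::real_normed_field \<Rightarrow> (nat \<Rightarrow> 'k) \<Rightarrow> (nat \<Rightarrow> 'k)" where
  "seq_scale c x = (\<lambda>n. c * x n)"

lemma vector_space_seq_scale: "vector_space seq_scale"
  by unfold_locales (auto simp: seq_scale_def fun_eq_iff algebra_simps)

definition Lambda1_norm :: "(nat \<Rightarrow> real) \<Rightarrow> nat \<Rightarrow> (nat \<Rightarrow> 'k::real_normed_field) \<Rightarrow> real" where
  "Lambda1_norm \<alpha> k x = (\<Sum>n. norm (x n) * exp (- \<alpha> n / real (Suc k)))"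

definition Lambda1 :: "(nat \<Rightarrow> real) \<Rightarrow> (nat \<Rightarrow> 'k::real_normed_field) set" where
  "Lambda1 \<alpha> = {x. \<forall>k. summable (\<lambda>n. norm (x n) * exp (- \<alpha> n / real (Suc k)))}"

definition Lambda_inf_norm :: "(nat \<Rightarrow> real) \<Rightarrow> nat \<Rightarrow> (nat \<Rightarrow> 'k::real_normed_field) \<Rightarrow> real" where
  "Lambda_inf_norm \<alpha> k x = (\<Sum>n. norm (x n) * exp (real (Suc k) * \<alpha> n))"

definition Lambda_inf :: "(nat \<Rightarrow> real) \<Rightarrow> (nat \<Rightarrow> 'k::real_normed_field) set" where
  "Lambda_inf \<alpha> = {x. \<forall>k. summable (\<lambda>n. norm (x n) * exp (real (Suc k) * \<alpha> n))}"

text \<open>The dual of \<open>Lambda_inf \<alpha>\<close>, identified with a space of sequences.\<close>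

definition Lambda_inf_dual :: "(nat \<Rightarrow> real) \<Rightarrow> (nat \<Rightarrow> 'k::real_normed_field) set" where
  "Lambda_inf_dual \<alpha> =
     {t. \<exists>k. bdd_above (range (\<lambda>n. norm (t n) * exp (- real (Suc k) * \<alpha> n)))}"

definition associated_exponent_sequence ::
  "('k::real_normed_field \<Rightarrow> 'a::ab_group_add \<Rightarrow> 'a) \<Rightarrow> 'a set \<Rightarrow> (nat \<Rightarrow> 'a \<Rightarrow> real) \<Rightarrow> (nat \<Rightarrow> real) \<Rightarrow> bool" where
  "associated_exponent_sequence s E nrm \<epsilon> \<longleftrightarrow>
     exponent_sequence \<epsilon> \<and>
     diametral_dimension seq_scale (Lambda1 \<epsilon>) (Lambda1_norm \<epsilon>) \<subseteq> diametral_dimension s E nrm \<and>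
     diametral_dimension s E nrm
       \<subseteq> diametral_dimension seq_scale (Lambda_inf \<epsilon>) (Lambda_inf_norm \<epsilon>) \<and>
     (\<forall>\<alpha>. exponent_sequence \<alpha> \<longrightarrow>
        (Lambda1 \<alpha> \<subseteq> diametral_dimension s E nrm \<longrightarrow>
           (Lambda1 \<alpha> :: (nat \<Rightarrow> 'k) set) \<subseteq> Lambda1 \<epsilon>) \<and>
        (diametral_dimension s E nrm \<subseteq> Lambda_inf_dual \<alpha> \<longrightarrow>
           (Lambda_inf_dual \<epsilon> :: (nat \<Rightarrow> 'k) set) \<subseteq> Lambda_inf_dual \<alpha>))"

end

theory Submission
  imports Defs "HOL-Library.Nat_Bijection"
begin

text \<open>
  The example is a Koethe space, a space of scalar sequences with weighted \<open>\<ell>\<^sup>1\<close>-norms given by weights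
  \<open>a p j\<close>. For such a space, nuclearity, the property DN and the property Omega are inequalities
  between weights, and the diameter \<open>d n q p\<close> of the unit ball of the \<open>q\<close>-th norm relative to the
  \<open>p\<close>-th is essentially the \<open>n\<close>-th largest quotient \<open>a p j / a q j\<close>: more than \<open>n\<close> indices with a large
  quotient bound it from below (\<open>le_kolmogorov_diameter\<close>), at most \<open>n\<close> such indices bound it from
  above (\<open>kolmogorov_diameter_le\<close>).

  The indices are cut into blocks, the \<open>s\<close>-th block having \<open>2 * 3 ^ s\<close> members. On block \<open>s\<close> the weights
  are those of a power series space of finite type, \<open>exp (- 2 ^ s / (p + 1))\<close>, except that every index
  also has one jump: from some \<open>p\<close> on, its weight is multiplied by the enormous factor \<open>exp (2 ^ s)\<close>. A
  block has a kind \<open>k\<close>; in one half of the block the jump occurs at \<open>k + 1\<close>, in the other half at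
  \<open>k\<close>. Each half has \<open>3 ^ s\<close> members, and the blocks before it have \<open>3 ^ s - 1\<close> members altogether.

  If \<open>q \<le> k\<close> or \<open>k \<le> p\<close>, then one of the halves has no jump between \<open>p\<close> and \<open>q\<close>, and it alone makes
  the diameters \<open>d n q p\<close> as large as in a power series space of finite type. If \<open>p < k < q\<close>, both
  halves jump and the diameters become small. The diametral dimension does not notice this. Its
  quantifiers let \<open>q\<close> depend on \<open>p\<close>; using first the pair \<open>(p, q)\<close> and then a pair \<open>(q, r)\<close>, every block
  falls into the first case for one of the two, since its kind is at least \<open>q\<close> or at most \<open>q\<close>. Hence the
  diametral dimension is that of the power series space with exponents \<open>2 ^ s\<close>
  (\<open>example_diametral_dimension\<close>), which is then the associated exponent sequence.

  A bounded set \<open>B\<close>, on the other hand, lies in multiples of all unit balls at the same time. At a block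
  of kind \<open>k\<close> its diameters can be estimated by means of the norm \<open>k + 1\<close>, and then both halves
  jump, for all \<open>p < k\<close> simultaneously. As every kind occurs arbitrarily late, the constant that \<open>B\<close> has
  for the norm \<open>k + 1\<close> is negligible at a suitable block of kind \<open>k\<close>. The blocks of one kind come in long runs, so that
  the blocks after the run have quotients of weights too small to spoil the estimate
  (\<open>growth_slope_in_window\<close>). Choosing such a block for each
  \<open>k\<close> gives a sequence of indices along which the diameters of \<open>B\<close> decay like \<open>exp (- 2 ^ s / 2)\<close> for
  every \<open>p\<close>. A sequence that lives on these indices and grows like \<open>exp (2 ^ s / 4)\<close> shows that \<open>B\<close> is not
  prominent (\<open>example_no_prominent_bounded_set\<close>).
\<close>

section \<open>Koethe sequence spaces\<close>

definition koethe_space :: "(nat \<Rightarrow> nat \<Rightarrow> real) \<Rightarrow> (nat \<Rightarrow> 'k::real_normed_field) set" where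
  "koethe_space a = {x. \<forall>p. summable (\<lambda>j. norm (x j) * a p j)}"

definition koethe_norm :: "(nat \<Rightarrow> nat \<Rightarrow> real) \<Rightarrow> nat \<Rightarrow> (nat \<Rightarrow> 'k::real_normed_field) \<Rightarrow> real" where
  "koethe_norm a p x = (\<Sum>j. norm (x j) * a p j)"

definition unit_vector :: "nat \<Rightarrow> nat \<Rightarrow> 'k::real_normed_field" where
  "unit_vector i = (\<lambda>j. if j = i then 1 else 0)"

interpretation seq: vector_space "seq_scale :: 'k::real_normed_field \<Rightarrow> _"
  by (rule vector_space_seq_scale)

lemma sum_sequences_apply:
  fixes f :: "'i \<Rightarrow> nat \<Rightarrow> 'k::real_normed_field"
  shows "(\<Sum>i\<in>A. f i) j = (\<Sum>i\<in>A. f i j)"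
  by (induction A rule: infinite_finite_induct) auto

lemma sum_unit_vectors_apply:
  fixes x :: "nat \<Rightarrow> 'k::real_normed_field"
  assumes "finite A"
  shows "(\<Sum>i\<in>A. seq_scale (x i) (unit_vector i)) j = (if j \<in> A then x j else 0)"
proof -
  have "(\<Sum>i\<in>A. seq_scale (x i) (unit_vector i)) j = (\<Sum>i\<in>A. if j = i then x i else 0)"
    unfolding sum_sequences_apply by (intro sum.cong) (auto simp: seq_scale_def unit_vector_def)
  then show ?thesis using assms by simp
qed

text \<open>
  A homogeneous linear system with more unknowns than equations has a nontrivial solution. It
  provides a functional that depends on \<open>n + 1\<close> prescribed coordinates only and vanishes on a given
  subspace of dimension at most \<open>n\<close>.
\<close>

lemma exists_annihilating_coefficients:
  fixes v :: "'i \<Rightarrow> 'j \<Rightarrow> 'k::field"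
  assumes "finite I" "finite F" "card I < card F"
  shows "\<exists>\<phi>. (\<exists>j\<in>F. \<phi> j \<noteq> 0) \<and> (\<forall>i\<in>I. (\<Sum>j\<in>F. \<phi> j * v i j) = 0)"
  using assms
proof (induction I arbitrary: F v rule: finite_induct)
  case empty
  then have "F \<noteq> {}" by auto
  then show ?case by (intro exI[of _ "\<lambda>_. 1"]) auto
next
  case (insert i0 I)
  have card: "Suc (card I) < card F" using insert by simp
  show ?case
  proof (cases "\<forall>j\<in>F. v i0 j = 0")
    case True
    then show ?thesis using insert.IH[OF insert.prems(1), of v] card by auto
  next
    case False
    then obtain j0 where j0: "j0 \<in> F" "v i0 j0 \<noteq> 0" by blast
    let ?F = "F - {j0}"
    have "card I < card ?F" using card j0 insert.prems(1) by simp
    then obtain \<phi> where \<phi>: "\<exists>j\<in>?F. \<phi> j \<noteq> 0"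
      and ann: "\<And>i. i \<in> I \<Longrightarrow> (\<Sum>j\<in>?F. \<phi> j * (v i j - v i j0 / v i0 j0 * v i0 j)) = 0"
      using insert.IH[of ?F "\<lambda>i j. v i j - v i j0 / v i0 j0 * v i0 j"] insert.prems(1) by auto
    define s where "s i = (\<Sum>j\<in>?F. \<phi> j * v i j)" for i
    \<comment> \<open>Gaussian elimination: the value at the pivot j0 is the one that solves the equation i0.\<close>
    define \<psi> where "\<psi> = \<phi>(j0 := - s i0 / v i0 j0)"
    have split: "(\<Sum>j\<in>F. \<psi> j * v i j) = - s i0 / v i0 j0 * v i j0 + s i" for i
    proof -
      have "(\<Sum>j\<in>F. \<psi> j * v i j) = \<psi> j0 * v i j0 + (\<Sum>j\<in>?F. \<psi> j * v i j)"
        using insert.prems(1) j0(1) by (rule sum.remove)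
      also have "(\<Sum>j\<in>?F. \<psi> j * v i j) = s i"
        unfolding s_def by (rule sum.cong) (auto simp: \<psi>_def)
      finally show ?thesis by (simp add: \<psi>_def)
    qed
    have "s i - v i j0 / v i0 j0 * s i0 = 0" if "i \<in> I" for i
      using ann[OF that] unfolding s_def
      by (simp add: right_diff_distrib sum_subtractf sum_distrib_left mult_ac)
    then have "(\<Sum>j\<in>F. \<psi> j * v i j) = 0" if "i \<in> insert i0 I" for i
      using that j0(2) unfolding split by (auto simp: mult_ac)
    moreover have "\<exists>j\<in>F. \<psi> j \<noteq> 0" using \<phi> by (auto simp: \<psi>_def)
    ultimately show ?thesis by blast
  qed
qed

locale koethe_matrix =
  fixes a :: "nat \<Rightarrow> nat \<Rightarrow> real"
  assumes weight_pos: "0 < a p j"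
    and weight_Suc: "a p j \<le> a (Suc p) j"
begin

lemma weight_nonneg: "0 \<le> a p j"
  using weight_pos by (rule less_imp_le)

lemma weight_mono: "p \<le> q \<Longrightarrow> a p j \<le> a q j"
  using weight_Suc by (rule lift_Suc_mono_le)

lemma koethe_summable: "x \<in> koethe_space a \<Longrightarrow> summable (\<lambda>j. norm (x j) * a p j)"
  by (simp add: koethe_space_def)

lemma koethe_norm_nonneg: "x \<in> koethe_space a \<Longrightarrow> 0 \<le> koethe_norm a p x"
  unfolding koethe_norm_def
  by (intro suminf_nonneg koethe_summable) (auto simp: weight_nonneg)

lemma finite_sum_le_koethe_norm:
  assumes "x \<in> koethe_space a" "finite A"
  shows "(\<Sum>j\<in>A. norm (x j) * a p j) \<le> koethe_norm a p x"
  unfolding koethe_norm_def using assms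
  by (intro sum_le_suminf koethe_summable) (auto simp: weight_nonneg)

lemma term_le_koethe_norm:
  assumes "x \<in> koethe_space a"
  shows "norm (x j) * a p j \<le> koethe_norm a p x"
  using finite_sum_le_koethe_norm[OF assms, of "{j}" p] by simp

lemma koethe_add:
  assumes "x \<in> koethe_space a" "y \<in> koethe_space a"
  shows "x + y \<in> koethe_space a" "koethe_norm a p (x + y) \<le> koethe_norm a p x + koethe_norm a p y"
proof -
  have *: "norm ((x + y) j) * a q j \<le> norm (x j) * a q j + norm (y j) * a q j" for q j
    using mult_right_mono[OF norm_triangle_ineq[of "x j" "y j"] weight_nonneg[of q j]]
    by (simp add: algebra_simps)
  show xy: "x + y \<in> koethe_space a"
    unfolding koethe_space_def
  proof safe
    fix q
    show "summable (\<lambda>j. norm ((x + y) j) * a q j)"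
      by (rule summable_comparison_test'[OF summable_add[OF koethe_summable[OF assms(1), of q]
              koethe_summable[OF assms(2), of q]], of 0])
         (use * weight_nonneg in auto)
  qed
  have "koethe_norm a p (x + y) \<le> (\<Sum>j. norm (x j) * a p j + norm (y j) * a p j)"
    unfolding koethe_norm_def by (intro suminf_le koethe_summable summable_add xy assms *)
  also have "\<dots> = koethe_norm a p x + koethe_norm a p y"
    unfolding koethe_norm_def by (intro suminf_add[symmetric] koethe_summable assms)
  finally show "koethe_norm a p (x + y) \<le> koethe_norm a p x + koethe_norm a p y" .
qed

lemma koethe_scale:
  assumes "x \<in> koethe_space a"
  shows "seq_scale c x \<in> koethe_space a" "koethe_norm a p (seq_scale c x) = norm c * koethe_norm a p x"
proof -
  have eq: "(\<lambda>j. norm (seq_scale c x j) * a q j) = (\<lambda>j. norm c * (norm (x j) * a q j))" for q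
    by (auto simp: seq_scale_def norm_mult)
  show "seq_scale c x \<in> koethe_space a"
    unfolding koethe_space_def
  proof safe
    fix q
    show "summable (\<lambda>j. norm (seq_scale c x j) * a q j)"
      unfolding eq by (intro summable_mult koethe_summable assms)
  qed
  show "koethe_norm a p (seq_scale c x) = norm c * koethe_norm a p x"
    unfolding koethe_norm_def eq by (rule suminf_mult[OF koethe_summable[OF assms]])
qed

lemma koethe_diff:
  assumes "x \<in> koethe_space a" "y \<in> koethe_space a"
  shows "x - y \<in> koethe_space a"
proof -
  have "x - y = x + seq_scale (-1) y" by (auto simp: seq_scale_def)
  then show ?thesis using koethe_add koethe_scale assms by metis
qed

lemma koethe_zero: "0 \<in> koethe_space a"
  by (simp add: koethe_space_def)

lemma koethe_sum:
  assumes "\<And>i. i \<in> A \<Longrightarrow> f i \<in> koethe_space a"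
  shows "(\<Sum>i\<in>A. f i) \<in> koethe_space a"
  using assms by (induction A rule: infinite_finite_induct) (auto intro: koethe_zero koethe_add)

lemma unit_vector_sums: "(\<lambda>j. norm (unit_vector i j :: 'k::real_normed_field) * a p j) sums a p i"
proof -
  have "(\<lambda>j. norm (unit_vector i j :: 'k) * a p j) = (\<lambda>j. if j = i then a p j else 0)"
    by (auto simp: unit_vector_def)
  then show ?thesis using sums_single[of i "a p"] by simp
qed

lemma unit_vector_mem: "unit_vector i \<in> koethe_space a"
  unfolding koethe_space_def using unit_vector_sums sums_summable by blast

lemma koethe_norm_unit_vector: "koethe_norm a p (unit_vector i) = a p i"
  unfolding koethe_norm_def using unit_vector_sums by (rule sums_unique[symmetric])

lemma koethe_norm_mono:
  assumes "x \<in> koethe_space a" "p \<le> q"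
  shows "koethe_norm a p x \<le> koethe_norm a q x"
  unfolding koethe_norm_def using assms
  by (intro suminf_le koethe_summable mult_left_mono weight_mono) auto

lemma koethe_subspace: "seq.subspace (koethe_space a)"
  unfolding seq.subspace_def using koethe_add koethe_scale koethe_zero by blast

lemma koethe_complete:
  fixes X :: "nat \<Rightarrow> nat \<Rightarrow> 'k::{real_normed_field, euclidean_space}"
  assumes mem: "\<And>n. X n \<in> koethe_space a"
    and cauchy: "\<And>k e. e > 0 \<Longrightarrow> \<exists>M. \<forall>m\<ge>M. \<forall>n\<ge>M. koethe_norm a k (X m - X n) < e"
  shows "\<exists>x\<in>koethe_space a. \<forall>k. (\<lambda>n. koethe_norm a k (X n - x)) \<longlonglongrightarrow> 0"
proof -
  have "Cauchy (\<lambda>n. X n j)" for j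
  proof (rule metric_CauchyI)
    fix e :: real assume "e > 0"
    then obtain M where M: "\<forall>m\<ge>M. \<forall>n\<ge>M. koethe_norm a 0 (X m - X n) < e * a 0 j"
      using cauchy[of "e * a 0 j" 0] weight_pos by (meson mult_pos_pos)
    have "dist (X m j) (X n j) < e" if "m \<ge> M" "n \<ge> M" for m n
    proof -
      have "norm ((X m - X n) j) * a 0 j < e * a 0 j"
        using term_le_koethe_norm[OF koethe_diff[OF mem mem], of m n j 0] M that
        by (meson le_less_trans)
      then show ?thesis using weight_pos[of 0 j] by (simp add: dist_norm)
    qed
    then show "\<exists>M. \<forall>m\<ge>M. \<forall>n\<ge>M. dist (X m j) (X n j) < e" by blast
  qed
  then have "\<forall>j. \<exists>l. (\<lambda>n. X n j) \<longlonglongrightarrow> l"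
    using Cauchy_convergent_iff convergent_def by blast
  then obtain x where x: "\<And>j. (\<lambda>n. X n j) \<longlonglongrightarrow> x j" by metis
  have close: "summable (\<lambda>j. norm ((X m - x) j) * a k j) \<and> koethe_norm a k (X m - x) \<le> e"
    if M: "\<forall>m\<ge>M. \<forall>n\<ge>M. koethe_norm a k (X m - X n) < e" and "m \<ge> M" for k e M m
  proof -
    \<comment> \<open>Finite partial sums pass to the coordinatewise limit, and their bound does not depend on N.\<close>
    have partial: "(\<Sum>j<N. norm ((X m - x) j) * a k j) \<le> e" for N
    proof (rule LIMSEQ_le_const2)
      show "(\<lambda>n. \<Sum>j<N. norm ((X m - X n) j) * a k j) \<longlonglongrightarrow> (\<Sum>j<N. norm ((X m - x) j) * a k j)"
        unfolding fun_diff_def by (intro tendsto_intros x)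
      show "\<exists>N'. \<forall>n\<ge>N'. (\<Sum>j<N. norm ((X m - X n) j) * a k j) \<le> e"
        using M finite_sum_le_koethe_norm[OF koethe_diff[OF mem mem], of "{..<N}" m _ k] \<open>m \<ge> M\<close>
        by (meson finite_lessThan le_less_trans less_imp_le)
    qed
    have "summable (\<lambda>j. norm ((X m - x) j) * a k j)"
      using partial by (intro summableI_nonneg_bounded[where x = e]) (auto simp: weight_nonneg)
    moreover from this have "koethe_norm a k (X m - x) \<le> e"
      unfolding koethe_norm_def by (rule suminf_le_const[OF _ partial])
    ultimately show ?thesis by blast
  qed
  have "summable (\<lambda>j. norm (x j) * a k j)" for k
  proof -
    obtain M where "\<forall>m\<ge>M. \<forall>n\<ge>M. koethe_norm a k (X m - X n) < 1"
      using cauchy[of 1 k] by auto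
    then have "summable (\<lambda>j. norm ((X M - x) j) * a k j)" using close by blast
    then have s: "summable (\<lambda>j. norm ((X M - x) j) * a k j + norm (X M j) * a k j)"
      by (rule summable_add[OF _ koethe_summable[OF mem]])
    have "norm (x j) * a k j \<le> norm ((X M - x) j) * a k j + norm (X M j) * a k j" for j
      using mult_right_mono[OF norm_triangle_ineq4[of "X M j" "X M j - x j"] weight_nonneg[of k j]]
      by (simp add: algebra_simps)
    then show ?thesis
      by (intro summable_comparison_test'[OF s, of 0]) (use weight_nonneg in auto)
  qed
  then have xmem: "x \<in> koethe_space a" by (simp add: koethe_space_def)
  moreover have "(\<lambda>n. koethe_norm a k (X n - x)) \<longlonglongrightarrow> 0" for k
  proof (rule LIMSEQ_I)
    fix e :: real assume "e > 0"
    then obtain M where M: "\<forall>m\<ge>M. \<forall>n\<ge>M. koethe_norm a k (X m - X n) < e / 2"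
      using cauchy[of "e / 2" k] by auto
    have "norm (koethe_norm a k (X n - x) - 0) < e" if "n \<ge> M" for n
      using close[OF M that] koethe_norm_nonneg[OF koethe_diff[OF mem xmem], of k n] \<open>e > 0\<close> by auto
    then show "\<exists>no. \<forall>n\<ge>no. norm (koethe_norm a k (X n - x) - 0) < e" by blast
  qed
  ultimately show ?thesis by blast
qed

lemma koethe_frechet:
  "frechet_space seq_scale (koethe_space a :: (nat \<Rightarrow> 'k::{real_normed_field, euclidean_space}) set)
     (koethe_norm a)"
  unfolding frechet_space_def
proof (intro conjI allI ballI impI)
  show "vector_space (seq_scale :: 'k \<Rightarrow> _)" by (rule vector_space_seq_scale)
  show "seq.subspace (koethe_space a :: (nat \<Rightarrow> 'k) set)" by (rule koethe_subspace)
  fix k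
  show "seminorm_on seq_scale (koethe_space a :: (nat \<Rightarrow> 'k) set) (koethe_norm a k)"
    unfolding seminorm_on_def
    by (intro conjI ballI allI koethe_norm_nonneg koethe_scale(2) koethe_add(2))
next
  fix k and x :: "nat \<Rightarrow> 'k"
  assume "x \<in> koethe_space a"
  then show "koethe_norm a k x \<le> koethe_norm a (Suc k) x" by (rule koethe_norm_mono) simp
next
  fix x :: "nat \<Rightarrow> 'k"
  assume "x \<in> koethe_space a" and "\<forall>k. koethe_norm a k x = 0"
  then have "norm (x j) * a 0 j \<le> 0" for j using term_le_koethe_norm[of x j 0] by simp
  then have "norm (x j) \<le> 0" for j using weight_pos[of 0 j] by (meson mult_le_cancel_right_pos order_trans mult_zero_left linorder_not_le mult_pos_pos)
  then have "x j = 0" for j by simp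
  then show "x = 0" by auto
next
  fix X :: "nat \<Rightarrow> nat \<Rightarrow> 'k"
  assume "(\<forall>n. X n \<in> koethe_space a) \<and>
    (\<forall>k e. e > 0 \<longrightarrow> (\<exists>M. \<forall>m\<ge>M. \<forall>n\<ge>M. koethe_norm a k (X m - X n) < e))"
  then show "\<exists>x\<in>koethe_space a. \<forall>k. (\<lambda>n. koethe_norm a k (X n - x)) \<longlonglongrightarrow> 0"
    by (intro koethe_complete) auto
qed

lemma koethe_norm_tail_tendsto_0:
  assumes x: "x \<in> koethe_space a"
  shows "(\<lambda>N. koethe_norm a p (x - (\<Sum>i<N. seq_scale (x i) (unit_vector i)))) \<longlonglongrightarrow> 0"
proof -
  have "koethe_norm a p (x - (\<Sum>i<N. seq_scale (x i) (unit_vector i)))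
      = koethe_norm a p x - (\<Sum>j<N. norm (x j) * a p j)" for N
  proof -
    let ?f = "\<lambda>j. norm ((x - (\<Sum>i<N. seq_scale (x i) (unit_vector i))) j) * a p j"
    have f: "?f j = (if j < N then 0 else norm (x j) * a p j)" for j
      by (simp add: sum_unit_vectors_apply)
    have "summable ?f"
      by (rule summable_comparison_test'[OF koethe_summable[OF x, of p], of 0])
         (unfold f, auto simp: weight_nonneg)
    then have "suminf ?f = (\<Sum>j. ?f (j + N)) + (\<Sum>j<N. ?f j)"
      by (rule suminf_split_initial_segment)
    also have "\<dots> = (\<Sum>j. norm (x (j + N)) * a p (j + N))"
      unfolding f by simp
    also have "\<dots> = koethe_norm a p x - (\<Sum>j<N. norm (x j) * a p j)"
      unfolding koethe_norm_def using suminf_minus_initial_segment[OF koethe_summable[OF x, of p]] by simp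
    finally show ?thesis unfolding koethe_norm_def .
  qed
  moreover have "(\<lambda>N. koethe_norm a p x - (\<Sum>j<N. norm (x j) * a p j)) \<longlonglongrightarrow> koethe_norm a p x - koethe_norm a p x"
    unfolding koethe_norm_def by (intro tendsto_intros summable_LIMSEQ koethe_summable x)
  ultimately show ?thesis by simp
qed

text \<open>
  The dual norm of a functional \<open>y\<close> is the supremum of \<open>norm (y (unit_vector i)) / a p i\<close>. This is
  split into the bounds that are used: an upper bound for coordinate functionals, and both bounds for
  the functionals in the dual.
\<close>

lemma dual_norm_coordinate_le:
  "dual_norm (koethe_space a) (koethe_norm a q) (\<lambda>x. x i :: 'k::real_normed_field) \<le> ennreal (1 / a q i)"
  unfolding dual_norm_def
proof (rule SUP_least, rule ennreal_leI)
  fix x :: "nat \<Rightarrow> 'k"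
  assume "x \<in> unit_ball (koethe_space a) (koethe_norm a q)"
  then have "norm (x i) * a q i \<le> 1"
    using term_le_koethe_norm[of x i q] by (auto simp: unit_ball_def)
  then show "norm (x i) \<le> 1 / a q i" using weight_pos[of q i] by (simp add: field_simps)
qed

text \<open>
  The expansion along the unit vectors is a nuclear representation as soon as the quotients of the
  weights are summable; this is the easy half of the Grothendieck-Pietsch criterion.
\<close>

lemma koethe_nuclear:
  assumes "\<And>p. \<exists>q\<ge>p. summable (\<lambda>j. a p j / a q j)"
  shows "nuclear_space seq_scale (koethe_space a :: (nat \<Rightarrow> 'k::real_normed_field) set) (koethe_norm a)"
  unfolding nuclear_space_def
proof
  fix p
  obtain q where q: "q \<ge> p" and s: "summable (\<lambda>j. a p j / a q j)" using assms by blast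
  let ?E = "koethe_space a :: (nat \<Rightarrow> 'k) set"
  let ?y = "\<lambda>i (x :: nat \<Rightarrow> 'k). x i"
  have "(\<Sum>i. dual_norm ?E (koethe_norm a q) (?y i) * ennreal (koethe_norm a p (unit_vector i :: nat \<Rightarrow> 'k)))
      \<le> (\<Sum>i. ennreal (a p i / a q i))"
  proof (rule suminf_le[OF _ summableI summableI])
    fix i
    have "dual_norm ?E (koethe_norm a q) (?y i) * ennreal (koethe_norm a p (unit_vector i :: nat \<Rightarrow> 'k))
        \<le> ennreal (1 / a q i) * ennreal (a p i)"
      unfolding koethe_norm_unit_vector by (intro mult_right_mono dual_norm_coordinate_le) simp
    also have "\<dots> = ennreal (a p i / a q i)"
      using weight_pos[of q i] weight_pos[of p i] by (simp add: ennreal_mult[symmetric])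
    finally show "dual_norm ?E (koethe_norm a q) (?y i) * ennreal (koethe_norm a p (unit_vector i :: nat \<Rightarrow> 'k))
      \<le> ennreal (a p i / a q i)" .
  qed
  also have "\<dots> < top"
  proof -
    have "(\<Sum>i. ennreal (a p i / a q i)) = ennreal (\<Sum>i. a p i / a q i)"
      by (rule suminf_ennreal2[OF _ s]) (intro divide_nonneg_nonneg weight_nonneg)
    then show ?thesis by (simp only: ennreal_less_top)
  qed
  finally have sum: "(\<Sum>i. dual_norm ?E (koethe_norm a q) (?y i)
      * ennreal (koethe_norm a p (unit_vector i :: nat \<Rightarrow> 'k))) < top" .
  have y: "linear_functional_on seq_scale ?E (?y i) \<and> dual_norm ?E (koethe_norm a q) (?y i) < top
      \<and> unit_vector i \<in> ?E" for i
    using le_less_trans[OF dual_norm_coordinate_le[of q i] ennreal_less_top]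
    by (simp add: linear_functional_on_def seq_scale_def unit_vector_mem)
  have "canonical_map_nuclear seq_scale ?E (koethe_norm a q) (koethe_norm a p)"
    unfolding canonical_map_nuclear_def
  proof (rule exI[of _ ?y], rule exI[of _ unit_vector], intro conjI)
    show "\<forall>i. linear_functional_on seq_scale ?E (?y i) \<and> dual_norm ?E (koethe_norm a q) (?y i) < top
      \<and> unit_vector i \<in> ?E"
      using y by blast
    show "\<forall>x\<in>?E. (\<lambda>N. koethe_norm a p (x - (\<Sum>i<N. seq_scale (x i) (unit_vector i)))) \<longlonglongrightarrow> 0"
      using koethe_norm_tail_tendsto_0 by blast
  qed (rule sum)
  then show "\<exists>q\<ge>p. canonical_map_nuclear seq_scale ?E (koethe_norm a q) (koethe_norm a p)"
    using q by blast
qed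

text \<open>
  Hoelder's inequality with exponents \<open>1 / lam\<close> and \<open>1 / (1 - lam)\<close>. After division by the two norms on
  the right it follows from summing Young's inequality over the coordinates.
\<close>

lemma koethe_norm_interpolation:
  assumes x: "x \<in> koethe_space a" and lam: "0 < lam" "lam < 1"
    and le: "\<And>i. a j i \<le> a k i powr lam * a l i powr (1 - lam)"
  shows "koethe_norm a j x \<le> koethe_norm a k x powr lam * koethe_norm a l x powr (1 - lam)"
proof (cases "koethe_norm a k x = 0 \<or> koethe_norm a l x = 0")
  case True
  then obtain m where "koethe_norm a m x = 0" by blast
  then have "norm (x i) * a m i \<le> 0" for i using term_le_koethe_norm[OF x, of i m] by simp
  then have "norm (x i) \<le> 0" for i using weight_pos[of m i]
    by (meson mult_pos_pos linorder_not_le)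
  then have "x = 0" by auto
  then show ?thesis by (simp add: koethe_norm_def)
next
  case False
  define A where "A = koethe_norm a k x"
  define B where "B = koethe_norm a l x"
  have pos: "A > 0" "B > 0"
    using False koethe_norm_nonneg[OF x, of k] koethe_norm_nonneg[OF x, of l] unfolding A_def B_def by linarith+
  define M where "M = A powr lam * B powr (1 - lam)"
  have "M > 0" using pos by (simp add: M_def)
  have termwise: "norm (x i) * a j i \<le> M * (lam * (norm (x i) * a k i / A) + (1 - lam) * (norm (x i) * a l i / B))" for i
  proof (cases "x i = 0")
    case False
    let ?u = "norm (x i) * a k i / A" and ?v = "norm (x i) * a l i / B"
    have uv: "?u > 0" "?v > 0" using False pos weight_pos by simp_all
    have nx: "norm (x i) = norm (x i) powr lam * norm (x i) powr (1 - lam)"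
      using False by (simp add: powr_add[symmetric])
    have "norm (x i) * a j i \<le> norm (x i) * (a k i powr lam * a l i powr (1 - lam))"
      by (intro mult_left_mono le) simp
    also have "\<dots> = (norm (x i) * a k i) powr lam * (norm (x i) * a l i) powr (1 - lam)"
      by (subst nx) (simp add: powr_mult)
    also have "\<dots> = (A * ?u) powr lam * (B * ?v) powr (1 - lam)"
      using pos by simp
    also have "\<dots> = M * (?u powr lam * ?v powr (1 - lam))"
      unfolding M_def powr_mult[of A ?u] powr_mult[of B ?v] by (simp add: mult_ac)
    also have "\<dots> \<le> M * (lam * ?u + (1 - lam) * ?v)"
      using lam uv \<open>M > 0\<close> by (intro mult_left_mono Youngs_inequality_0) auto
    finally show ?thesis .
  qed simp
  have sA: "(\<lambda>i. norm (x i) * a k i) sums A" and sB: "(\<lambda>i. norm (x i) * a l i) sums B"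
    unfolding A_def B_def koethe_norm_def by (intro summable_sums koethe_summable x)+
  have "(\<lambda>i. M * (lam * (norm (x i) * a k i / A) + (1 - lam) * (norm (x i) * a l i / B)))
      sums (M * (lam * (A / A) + (1 - lam) * (B / B)))"
    by (intro sums_mult sums_add sums_divide sA sB)
  moreover have "M * (lam * (A / A) + (1 - lam) * (B / B)) = M" using pos by simp
  ultimately have s: "(\<lambda>i. M * (lam * (norm (x i) * a k i / A) + (1 - lam) * (norm (x i) * a l i / B))) sums M"
    by (simp only:)
  have "koethe_norm a j x \<le> M"
    unfolding koethe_norm_def
    using suminf_le[OF termwise koethe_summable[OF x] sums_summable[OF s]] sums_unique[OF s] by simp
  then show ?thesis unfolding M_def A_def B_def .
qed

lemma koethe_DN:
  assumes "\<And>j. \<exists>l lam. 0 < lam \<and> lam < 1 \<and> (\<forall>i. a j i \<le> a k i powr lam * a l i powr (1 - lam))"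
  shows "DN_property (koethe_space a :: (nat \<Rightarrow> 'k::real_normed_field) set) (koethe_norm a)"
  unfolding DN_property_def
proof (rule exI[of _ k], rule allI)
  fix j
  obtain l lam where lam: "0 < lam" "lam < 1" and le: "\<And>i. a j i \<le> a k i powr lam * a l i powr (1 - lam)"
    using assms[of j] by blast
  have "\<forall>x\<in>koethe_space a :: (nat \<Rightarrow> 'k) set.
      koethe_norm a j x \<le> 1 * koethe_norm a k x powr lam * koethe_norm a l x powr (1 - lam)"
    by (intro ballI) (simp add: koethe_norm_interpolation[OF _ lam le])
  then show "\<exists>l. \<exists>C>0. \<exists>lam. 0 < lam \<and> lam < 1 \<and> (\<forall>x\<in>koethe_space a :: (nat \<Rightarrow> 'k) set.
      koethe_norm a j x \<le> C * koethe_norm a k x powr lam * koethe_norm a l x powr (1 - lam))"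
    using lam zero_less_one by blast
qed

lemma functional_sum:
  fixes y :: "(nat \<Rightarrow> 'k::real_normed_field) \<Rightarrow> 'k"
  assumes y: "linear_functional_on seq_scale (koethe_space a) y" and "finite A"
  shows "y (\<Sum>i\<in>A. seq_scale (c i) (unit_vector i)) = (\<Sum>i\<in>A. c i * y (unit_vector i))"
  using \<open>finite A\<close>
proof (induction A rule: finite_induct)
  case empty
  have "y (0 + 0) = y 0 + y 0" using y koethe_zero unfolding linear_functional_on_def by blast
  then have "y 0 = 0" by simp
  then show ?case by (simp only: sum.empty)
next
  case (insert i A)
  have m: "seq_scale (c i) (unit_vector i :: nat \<Rightarrow> 'k) \<in> koethe_space a"
    "(\<Sum>i\<in>A. seq_scale (c i) (unit_vector i)) \<in> (koethe_space a :: (nat \<Rightarrow> 'k) set)"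
    by (intro koethe_sum koethe_scale(1) unit_vector_mem)+
  have "y (seq_scale (c i) (unit_vector i) + (\<Sum>i\<in>A. seq_scale (c i) (unit_vector i)))
      = y (seq_scale (c i) (unit_vector i)) + y (\<Sum>i\<in>A. seq_scale (c i) (unit_vector i))"
    using y m unfolding linear_functional_on_def by blast
  also have "y (seq_scale (c i) (unit_vector i)) = c i * y (unit_vector i)"
    using y unit_vector_mem unfolding linear_functional_on_def by blast
  finally show ?case using insert by simp
qed

lemma coordinate_le_dual_norm:
  fixes y :: "(nat \<Rightarrow> 'k::real_normed_field) \<Rightarrow> 'k"
  assumes "linear_functional_on seq_scale (koethe_space a) y"
  shows "ennreal (norm (y (unit_vector i)) / a p i) \<le> dual_norm (koethe_space a) (koethe_norm a p) y"
proof -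
  let ?x = "seq_scale (of_real (1 / a p i)) (unit_vector i) :: nat \<Rightarrow> 'k"
  have "?x \<in> unit_ball (koethe_space a) (koethe_norm a p)"
    unfolding unit_ball_def using weight_pos[of p i]
    by (simp add: koethe_scale unit_vector_mem koethe_norm_unit_vector norm_divide)
  moreover have "y ?x = of_real (1 / a p i) * y (unit_vector i)"
    using assms unit_vector_mem unfolding linear_functional_on_def by blast
  then have "norm (y ?x) = norm (y (unit_vector i)) / a p i"
    using weight_pos[of p i] by (simp add: norm_mult norm_divide)
  ultimately show ?thesis unfolding dual_norm_def by (metis SUP_upper)
qed

text \<open>
  Boundedness of \<open>y\<close> by some norm is what carries the estimate from finite sections of \<open>x\<close> to \<open>x\<close>
  itself.
\<close>

lemma dual_norm_le:
  fixes y :: "(nat \<Rightarrow> 'k::real_normed_field) \<Rightarrow> 'k"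
  assumes y: "y \<in> topological_dual seq_scale (koethe_space a) (koethe_norm a)"
    and le: "\<And>i. norm (y (unit_vector i)) \<le> D * a q i" and "0 \<le> D"
  shows "dual_norm (koethe_space a) (koethe_norm a q) y \<le> ennreal D"
  unfolding dual_norm_def
proof (rule SUP_least, rule ennreal_leI)
  fix x :: "nat \<Rightarrow> 'k"
  assume "x \<in> unit_ball (koethe_space a) (koethe_norm a q)"
  then have x: "x \<in> koethe_space a" and x1: "koethe_norm a q x \<le> 1" by (auto simp: unit_ball_def)
  obtain k C where lin: "linear_functional_on seq_scale (koethe_space a) y"
    and C: "\<And>x. x \<in> koethe_space a \<Longrightarrow> norm (y x) \<le> C * koethe_norm a k x"
    using y unfolding topological_dual_def by blast
  define T where "T N = (\<Sum>i<N. seq_scale (x i) (unit_vector i :: nat \<Rightarrow> 'k))" for N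
  have T: "T N \<in> koethe_space a" for N
    unfolding T_def by (intro koethe_sum koethe_scale(1) unit_vector_mem)
  have diff: "y x - y (T N) = y (x - T N)" for N
  proof -
    have "y ((x - T N) + T N) = y (x - T N) + y (T N)"
      using lin T koethe_diff[OF x T] unfolding linear_functional_on_def by blast
    then show ?thesis by simp
  qed
  have partial: "norm (y (T N)) \<le> D" for N
  proof -
    have "norm (y (T N)) = norm (\<Sum>i<N. x i * y (unit_vector i))"
      unfolding T_def functional_sum[OF lin finite_lessThan] ..
    also have "\<dots> \<le> (\<Sum>i<N. D * (norm (x i) * a q i))"
    proof (rule sum_norm_le)
      fix i
      show "norm (x i * y (unit_vector i)) \<le> D * (norm (x i) * a q i)"
        using mult_left_mono[OF le[of i], of "norm (x i)"] by (simp add: norm_mult mult_ac)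
    qed
    also have "\<dots> = D * (\<Sum>i<N. norm (x i) * a q i)" by (simp add: sum_distrib_left)
    also have "\<dots> \<le> D * 1"
      using finite_sum_le_koethe_norm[OF x, of "{..<N}" q] x1 \<open>0 \<le> D\<close> by (intro mult_left_mono) auto
    finally show ?thesis by simp
  qed
  have "(\<lambda>N. C * koethe_norm a k (x - T N)) \<longlonglongrightarrow> C * 0"
    unfolding T_def by (intro tendsto_intros koethe_norm_tail_tendsto_0 x)
  then have "(\<lambda>N. D + C * koethe_norm a k (x - T N)) \<longlonglongrightarrow> D"
    using tendsto_add[OF tendsto_const[of D]] by fastforce
  moreover have "norm (y x) \<le> D + C * koethe_norm a k (x - T N)" for N
    using norm_triangle_sub[of "y x" "y (T N)"] partial[of N] C[OF koethe_diff[OF x T], of N]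
    unfolding diff by linarith
  ultimately show "norm (y x) \<le> D"
    by (intro LIMSEQ_le_const) auto
qed

text \<open>
  The dual norms are weighted supremum norms with the weights \<open>1 / a p i\<close>, so an inequality between
  the weights gives Omega coordinate by coordinate, with constant 1.
\<close>

lemma koethe_Omega:
  assumes "\<And>p. \<exists>q. \<forall>k. \<exists>\<theta>. 0 < \<theta> \<and> \<theta> < 1 \<and> (\<forall>i. a p i powr (1 - \<theta>) * a k i powr \<theta> \<le> a q i)"
  shows "Omega_property seq_scale (koethe_space a :: (nat \<Rightarrow> 'k::real_normed_field) set) (koethe_norm a)"
  unfolding Omega_property_def
proof
  fix p
  let ?E = "koethe_space a :: (nat \<Rightarrow> 'k) set"
  let ?d = "\<lambda>p (y :: (nat \<Rightarrow> 'k) \<Rightarrow> 'k). dual_norm ?E (koethe_norm a p) y"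
  obtain q where q: "\<And>k. \<exists>\<theta>. 0 < \<theta> \<and> \<theta> < 1 \<and> (\<forall>i. a p i powr (1 - \<theta>) * a k i powr \<theta> \<le> a q i)"
    using assms[of p] by blast
  have "\<exists>C>0. \<exists>\<theta>. 0 < \<theta> \<and> \<theta> < 1 \<and> (\<forall>y\<in>topological_dual seq_scale ?E (koethe_norm a).
      ?d q y \<le> ennreal C * ennreal_rpow (?d p y) (1 - \<theta>) * ennreal_rpow (?d k y) \<theta>)" for k
  proof -
    obtain \<theta> where \<theta>: "0 < \<theta>" "\<theta> < 1" and le: "\<And>i. a p i powr (1 - \<theta>) * a k i powr \<theta> \<le> a q i"
      using q[of k] by blast
    have "?d q y \<le> ennreal_rpow (?d p y) (1 - \<theta>) * ennreal_rpow (?d k y) \<theta>"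
      if y: "y \<in> topological_dual seq_scale ?E (koethe_norm a)" for y
    proof -
      have lin: "linear_functional_on seq_scale ?E y" using y by (simp add: topological_dual_def)
      consider "\<And>i. y (unit_vector i) = 0"
        | i where "y (unit_vector i) \<noteq> 0" "?d p y = top \<or> ?d k y = top"
        | "?d p y \<noteq> top" "?d k y \<noteq> top" by blast
      then show ?thesis
      proof cases
        case 1
        then have "?d q y \<le> ennreal 0" using y by (intro dual_norm_le) auto
        then show ?thesis by simp
      next
        case (2 i)
        \<comment> \<open>Neither factor vanishes, so the product is infinite and not 0 times infinity, which is 0.\<close>
        have pos: "ennreal_rpow (?d m y) r \<noteq> 0" for m r
        proof -
          have "0 < ennreal (norm (y (unit_vector i)) / a m i)"
            using 2(1) weight_pos[of m i] by simp
          also have "\<dots> \<le> ?d m y" by (rule coordinate_le_dual_norm[OF lin])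
          finally have "?d m y = top \<or> enn2real (?d m y) > 0"
            by (auto simp: enn2real_positive_iff less_top[symmetric])
          then show ?thesis unfolding ennreal_rpow_def by auto
        qed
        from 2(2) have "ennreal_rpow (?d p y) (1 - \<theta>) = top \<or> ennreal_rpow (?d k y) \<theta> = top"
          by (auto simp: ennreal_rpow_def)
        then have "ennreal_rpow (?d p y) (1 - \<theta>) * ennreal_rpow (?d k y) \<theta> = top"
          using pos by (auto simp: ennreal_mult_eq_top_iff)
        then show ?thesis by simp
      next
        case 3
        define P where "P = enn2real (?d p y)"
        define K where "K = enn2real (?d k y)"
        have nn: "P \<ge> 0" "K \<ge> 0" by (simp_all add: P_def K_def)
        have bound: "norm (y (unit_vector i)) \<le> enn2real (?d m y) * a m i" if "?d m y \<noteq> top" for m i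
        proof -
          have "norm (y (unit_vector i)) / a m i \<le> enn2real (?d m y)"
            using enn2real_mono[OF coordinate_le_dual_norm[OF lin, of i m]] that weight_pos[of m i]
            by (simp add: less_top)
          then show ?thesis using weight_pos[of m i] by (simp add: field_simps)
        qed
        have "norm (y (unit_vector i)) \<le> (P powr (1 - \<theta>) * K powr \<theta>) * a q i" for i
        proof -
          let ?t = "norm (y (unit_vector i))"
          have "?t = ?t powr (1 - \<theta>) * ?t powr \<theta>"
            by (cases "?t = 0") (simp_all add: powr_add[symmetric])
          also have "\<dots> \<le> (P * a p i) powr (1 - \<theta>) * (K * a k i) powr \<theta>"
            using bound[OF 3(1), of i] bound[OF 3(2), of i] \<theta> unfolding P_def[symmetric] K_def[symmetric]
            by (intro mult_mono powr_mono2) auto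
          also have "\<dots> = (P powr (1 - \<theta>) * K powr \<theta>) * (a p i powr (1 - \<theta>) * a k i powr \<theta>)"
            by (simp add: powr_mult mult_ac)
          also have "\<dots> \<le> (P powr (1 - \<theta>) * K powr \<theta>) * a q i"
            by (intro mult_left_mono le) simp
          finally show ?thesis .
        qed
        then have "?d q y \<le> ennreal (P powr (1 - \<theta>) * K powr \<theta>)" using y by (intro dual_norm_le) auto
        also have "\<dots> = ennreal_rpow (?d p y) (1 - \<theta>) * ennreal_rpow (?d k y) \<theta>"
          using 3 unfolding ennreal_rpow_def P_def K_def by (simp add: ennreal_mult)
        finally show ?thesis .
      qed
    qed
    then have "\<forall>y\<in>topological_dual seq_scale ?E (koethe_norm a).
        ?d q y \<le> ennreal 1 * ennreal_rpow (?d p y) (1 - \<theta>) * ennreal_rpow (?d k y) \<theta>"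
      by simp
    then show ?thesis using \<theta> zero_less_one by blast
  qed
  then show "\<exists>q. \<forall>k. \<exists>C>0. \<exists>\<theta>. 0 < \<theta> \<and> \<theta> < 1 \<and> (\<forall>y\<in>topological_dual seq_scale ?E (koethe_norm a).
      ?d q y \<le> ennreal C * ennreal_rpow (?d p y) (1 - \<theta>) * ennreal_rpow (?d k y) \<theta>)"
    by blast
qed

section \<open>Kolmogorov diameters of Koethe spaces\<close>

text \<open>
  The subspace spanned by the coordinates in \<open>J\<close> is good enough: what is left of \<open>x\<close> after deleting
  these coordinates is controlled by the quotients of the weights outside \<open>J\<close>. Since the diameter is an infimum of
  a set of reals, whose value says nothing when the set is empty, nonnegativity is obtained
  from the same witness.
\<close>

lemma kolmogorov_diameter_le:
  fixes V :: "(nat \<Rightarrow> 'k::real_normed_field) set"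
  assumes V: "\<And>x. x \<in> V \<Longrightarrow> x \<in> koethe_space a \<and> koethe_norm a q x \<le> C"
    and pos: "C > 0" "\<tau> > 0"
    and J: "finite J" "card J \<le> n" "\<And>j. j \<notin> J \<Longrightarrow> C * a p j \<le> \<tau> * a q j"
  shows "kolmogorov_diameter seq_scale (koethe_space a) n V (unit_ball (koethe_space a) (koethe_norm a p)) \<le> \<tau>"
    and "0 \<le> kolmogorov_diameter seq_scale (koethe_space a) n V (unit_ball (koethe_space a) (koethe_norm a p))"
proof -
  let ?U = "unit_ball (koethe_space a) (koethe_norm a p) :: (nat \<Rightarrow> 'k) set"
  let ?B = "unit_vector ` J :: (nat \<Rightarrow> 'k) set"
  have "V \<subseteq> {seq_scale (of_real \<tau>) u + l |u l. u \<in> ?U \<and> l \<in> seq.span ?B}"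
  proof
    fix x assume "x \<in> V"
    then have x: "x \<in> koethe_space a" and xC: "koethe_norm a q x \<le> C" using V by auto
    define l where "l = (\<Sum>j\<in>J. seq_scale (x j) (unit_vector j :: nat \<Rightarrow> 'k))"
    define u where "u = seq_scale (of_real (1 / \<tau>)) (x - l)"
    have l: "l \<in> koethe_space a" unfolding l_def by (intro koethe_sum koethe_scale(1) unit_vector_mem)
    note xl = koethe_diff[OF x l]
    have "norm ((x - l) j) * a p j \<le> \<tau> / C * (norm (x j) * a q j)" for j
    proof (cases "j \<in> J")
      case False
      have "norm (x j) * (C * a p j) \<le> norm (x j) * (\<tau> * a q j)"
        by (intro mult_left_mono J False) simp
      then show ?thesis using False pos
        by (simp add: l_def sum_unit_vectors_apply[OF J(1)] field_simps)
    qed (use pos weight_nonneg in \<open>simp add: l_def sum_unit_vectors_apply[OF J(1)]\<close>)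
    then have "koethe_norm a p (x - l) \<le> (\<Sum>j. \<tau> / C * (norm (x j) * a q j))"
      unfolding koethe_norm_def by (intro suminf_le koethe_summable[OF xl] summable_mult koethe_summable x)
    also have "\<dots> = \<tau> / C * koethe_norm a q x"
      unfolding koethe_norm_def by (rule suminf_mult[OF koethe_summable[OF x]])
    also have "\<dots> \<le> \<tau> / C * C" using pos xC by (intro mult_left_mono) auto
    finally have "koethe_norm a p (x - l) \<le> \<tau>" using pos by simp
    then have "u \<in> ?U"
      unfolding unit_ball_def u_def using pos by (simp add: koethe_scale xl norm_divide)
    moreover have "l \<in> seq.span ?B"
      unfolding l_def by (intro seq.span_sum seq.span_scale seq.span_base) auto
    moreover have "x = seq_scale (of_real \<tau>) u + l"
      using pos by (auto simp: u_def seq_scale_def fun_eq_iff)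
    ultimately show "x \<in> {seq_scale (of_real \<tau>) u + l |u l. u \<in> ?U \<and> l \<in> seq.span ?B}" by blast
  qed
  then have mem: "\<tau> \<in> {t. 0 < t \<and> (\<exists>B. finite B \<and> card B \<le> n \<and> B \<subseteq> koethe_space a \<and>
      V \<subseteq> {seq_scale (of_real t) u + l |u l. u \<in> ?U \<and> l \<in> seq.span B})}" (is "_ \<in> ?T")
    using pos J(1)
    by (intro CollectI conjI exI[of _ ?B])
       (auto intro: order_trans[OF card_image_le[OF J(1)] J(2)] unit_vector_mem)
  then show "kolmogorov_diameter seq_scale (koethe_space a) n V ?U \<le> \<tau>"
    unfolding kolmogorov_diameter_def by (rule cInf_lower) (auto intro!: bdd_belowI[of _ 0])
  have "?T \<noteq> {}" using mem by blast
  then show "0 \<le> kolmogorov_diameter seq_scale (koethe_space a) n V ?U"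
    unfolding kolmogorov_diameter_def by (rule cInf_greatest) auto
qed

text \<open>
  Let the unit ball \<open>V\<close> of the \<open>q\<close>-th norm be contained in \<open>t\<close> times the unit ball \<open>U\<close> of the \<open>p\<close>-th norm
  plus a subspace of dimension at most \<open>n\<close>. Some functional \<open>\<phi>\<close> on the coordinates in \<open>F\<close> vanishes
  on the subspace. On \<open>U\<close> it is bounded by the maximum \<open>r m\<close> of \<open>norm (\<phi> j) / a p j\<close>, which is attained
  at a single index \<open>m\<close>; for \<open>\<ell>\<^sup>1\<close>-norms it therefore suffices to test the inclusion with the \<open>m\<close>-th unit
  vector.
\<close>

lemma le_kolmogorov_diameter:
  assumes "p \<le> q" and F: "finite F" "n < card F" "\<And>j. j \<in> F \<Longrightarrow> c * a q j \<le> a p j"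
  shows "c \<le> kolmogorov_diameter seq_scale (koethe_space a :: (nat \<Rightarrow> 'k::real_normed_field) set) n
    (unit_ball (koethe_space a) (koethe_norm a q)) (unit_ball (koethe_space a) (koethe_norm a p))"
  unfolding kolmogorov_diameter_def
proof (rule cInf_greatest)
  let ?E = "koethe_space a :: (nat \<Rightarrow> 'k) set"
  let ?U = "\<lambda>p. unit_ball ?E (koethe_norm a p)"
  let ?T = "{t. 0 < t \<and> (\<exists>B. finite B \<and> card B \<le> n \<and> B \<subseteq> ?E \<and>
      ?U q \<subseteq> {seq_scale (of_real t) u + l |u l. u \<in> ?U p \<and> l \<in> seq.span B})}"
  have "?U q \<subseteq> {seq_scale (of_real 1) u + l |u l. u \<in> ?U p \<and> l \<in> seq.span {}}"
  proof
    fix x assume "x \<in> ?U q"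
    then have "x \<in> ?U p"
      using koethe_norm_mono[OF _ \<open>p \<le> q\<close>, of x] by (auto simp: unit_ball_def)
    moreover have "x = seq_scale (of_real 1) x + 0" by (simp add: seq_scale_def)
    ultimately show "x \<in> {seq_scale (of_real 1) u + l |u l. u \<in> ?U p \<and> l \<in> seq.span {}}"
      using seq.span_zero by blast
  qed
  then have "1 \<in> ?T" by (intro CollectI conjI exI[of _ "{}"]) auto
  then show "?T \<noteq> {}" by blast
  fix t assume "t \<in> ?T"
  then obtain B where t: "t > 0" and B: "finite B" "card B \<le> n"
    and sub: "?U q \<subseteq> {seq_scale (of_real t) u + l |u l. u \<in> ?U p \<and> l \<in> seq.span B}" by blast
  obtain \<phi> where \<phi>: "\<exists>j\<in>F. \<phi> j \<noteq> 0" and ann: "\<And>b. b \<in> B \<Longrightarrow> (\<Sum>j\<in>F. \<phi> j * b j) = 0"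
    using exists_annihilating_coefficients[OF B(1) F(1), of "\<lambda>b j. b j"] B F by auto
  have "seq.subspace {x :: nat \<Rightarrow> 'k. (\<Sum>j\<in>F. \<phi> j * x j) = 0}"
    unfolding seq.subspace_def
    by (auto simp: seq_scale_def distrib_left sum.distrib mult.left_commute sum_distrib_left[symmetric])
  then have ann_span: "(\<Sum>j\<in>F. \<phi> j * l j) = 0" if "l \<in> seq.span B" for l
    using seq.span_minimal[of B "{x. (\<Sum>j\<in>F. \<phi> j * x j) = 0}"] ann that by blast
  define r where "r j = norm (\<phi> j) / a p j" for j
  have "Max (r ` F) \<in> r ` F" using F by (intro Max_in) auto
  then obtain m where m: "m \<in> F" and "r m = Max (r ` F)" by auto
  then have max: "r j \<le> r m" if "j \<in> F" for j using that F(1) by simp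
  obtain j1 where "j1 \<in> F" "\<phi> j1 \<noteq> 0" using \<phi> by blast
  then have "0 < r j1" "r j1 \<le> r m" using weight_pos[of p j1] max by (auto simp: r_def)
  then have rm: "0 < r m" by linarith
  let ?v = "seq_scale (of_real (1 / a q m)) (unit_vector m) :: nat \<Rightarrow> 'k"
  have "?v \<in> ?U q"
    unfolding unit_ball_def using weight_pos[of q m]
    by (simp add: koethe_scale unit_vector_mem koethe_norm_unit_vector norm_divide)
  then obtain u l where u: "u \<in> ?U p" and l: "l \<in> seq.span B" and v: "?v = seq_scale (of_real t) u + l"
    using sub by blast
  have "(\<Sum>j\<in>F. \<phi> j * ?v j) = (\<Sum>j\<in>F. if j = m then \<phi> m * of_real (1 / a q m) else 0)"
    by (rule sum.cong) (auto simp: seq_scale_def unit_vector_def)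
  also have "\<dots> = \<phi> m * of_real (1 / a q m)" using F(1) m by simp
  finally have "\<phi> m * of_real (1 / a q m) = (\<Sum>j\<in>F. \<phi> j * (seq_scale (of_real t) u + l) j)"
    using v by simp
  also have "\<dots> = of_real t * (\<Sum>j\<in>F. \<phi> j * u j)"
    using ann_span[OF l] by (simp add: seq_scale_def distrib_left sum.distrib sum_distrib_left mult_ac)
  finally have "norm (\<phi> m * of_real (1 / a q m)) = norm (of_real t * (\<Sum>j\<in>F. \<phi> j * u j))" by simp
  then have "norm (\<phi> m) / a q m = t * norm (\<Sum>j\<in>F. \<phi> j * u j)"
    using t weight_pos[of q m] by (simp add: norm_mult norm_divide)
  also have "norm (\<Sum>j\<in>F. \<phi> j * u j) \<le> (\<Sum>j\<in>F. r m * (norm (u j) * a p j))"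
  proof (rule sum_norm_le)
    fix j assume "j \<in> F"
    have "norm (\<phi> j * u j) = r j * (norm (u j) * a p j)"
      using weight_pos[of p j] by (simp add: r_def norm_mult)
    also have "\<dots> \<le> r m * (norm (u j) * a p j)"
      using max[OF \<open>j \<in> F\<close>] weight_nonneg by (intro mult_right_mono) auto
    finally show "norm (\<phi> j * u j) \<le> r m * (norm (u j) * a p j)" .
  qed
  also have "\<dots> = r m * (\<Sum>j\<in>F. norm (u j) * a p j)" by (rule sum_distrib_left[symmetric])
  also have "\<dots> \<le> r m * 1"
    using u finite_sum_le_koethe_norm[of u F p] F(1) rm by (intro mult_left_mono) (auto simp: unit_ball_def)
  finally have "norm (\<phi> m) / a q m \<le> t * r m" using t by simp
  moreover have "norm (\<phi> m) = r m * a p m" using weight_pos[of p m] by (simp add: r_def)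
  ultimately have "r m * a p m \<le> r m * (t * a q m)"
    using weight_pos[of q m] by (simp add: field_simps)
  then have "a p m \<le> t * a q m" using rm by simp
  then have "c * a q m \<le> t * a q m" using F(3)[OF m] by linarith
  then show "c \<le> t" using weight_pos[of q m] by simp
qed

lemma kolmogorov_diameter_initial_segment:
  fixes n :: nat
  assumes "\<tau> > 0" "\<And>j. n \<le> j \<Longrightarrow> a p j \<le> \<tau> * a q j"
  defines "d \<equiv> kolmogorov_diameter seq_scale (koethe_space a :: (nat \<Rightarrow> 'k::real_normed_field) set) n
    (unit_ball (koethe_space a) (koethe_norm a q)) (unit_ball (koethe_space a) (koethe_norm a p))"
  shows "d \<le> \<tau>" "0 \<le> d"
  unfolding d_def using assms
  by (intro kolmogorov_diameter_le[where q = q and C = 1 and J = "{..<n}" and \<tau> = \<tau>]; auto simp: unit_ball_def)+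

end

section \<open>Diametral dimension and subexponential growth\<close>

text \<open>
  For an exponent sequence \<open>\<epsilon>\<close> this is the diametral dimension of the power series space of finite
  type given by \<open>\<epsilon>\<close>, and in the nuclear case it is that space itself. All diametral dimensions below are
  compared with it.
\<close>

definition subexponential :: "(nat \<Rightarrow> real) \<Rightarrow> (nat \<Rightarrow> 'k::real_normed_field) set" where
  "subexponential \<epsilon> = {x. \<forall>\<delta>>0. (\<lambda>n. norm (x n) * exp (- \<delta> * \<epsilon> n)) \<longlonglongrightarrow> 0}"

context koethe_matrix
begin

abbreviation ball_diameter :: "'k::real_normed_field itself \<Rightarrow> nat \<Rightarrow> nat \<Rightarrow> nat \<Rightarrow> real" where
  "ball_diameter _ n q p \<equiv> kolmogorov_diameter seq_scale (koethe_space a :: (nat \<Rightarrow> 'k) set) n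
     (unit_ball (koethe_space a) (koethe_norm a q)) (unit_ball (koethe_space a) (koethe_norm a p))"

lemma ball_diameter_nonneg:
  assumes "p \<le> q"
  shows "0 \<le> ball_diameter TYPE('k::real_normed_field) n q p"
  using weight_mono[OF assms] by (intro kolmogorov_diameter_initial_segment(2)[of 1]) auto

lemma mem_diametral_dimension_iff:
  fixes x :: "nat \<Rightarrow> 'k::real_normed_field"
  shows "x \<in> diametral_dimension seq_scale (koethe_space a) (koethe_norm a) \<longleftrightarrow>
    (\<forall>p. \<exists>q>p. (\<lambda>n. norm (x n) * ball_diameter TYPE('k) n q p) \<longlonglongrightarrow> 0)"
proof -
  have "((\<lambda>n. x n * of_real (ball_diameter TYPE('k) n q p)) \<longlonglongrightarrow> 0) \<longleftrightarrow>
      ((\<lambda>n. norm (x n) * ball_diameter TYPE('k) n q p) \<longlonglongrightarrow> 0)" if "p < q" for p q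
  proof -
    have "norm (x n * of_real (ball_diameter TYPE('k) n q p)) = norm (x n) * ball_diameter TYPE('k) n q p" for n
      using that by (simp add: norm_mult ball_diameter_nonneg)
    then show ?thesis
      using tendsto_norm_zero_iff[of "\<lambda>n. x n * of_real (ball_diameter TYPE('k) n q p)"] by simp
  qed
  then show ?thesis unfolding diametral_dimension_def by blast
qed

lemma subexponential_subset_diametral_dimension:
  assumes "\<And>p. \<exists>q>p. \<exists>c>0. \<forall>n j. n \<le> j \<longrightarrow> a p j \<le> exp (- c * \<epsilon> n) * a q j"
  shows "(subexponential \<epsilon> :: (nat \<Rightarrow> 'k::real_normed_field) set)
    \<subseteq> diametral_dimension seq_scale (koethe_space a) (koethe_norm a)"
proof
  fix x :: "nat \<Rightarrow> 'k"
  assume x: "x \<in> subexponential \<epsilon>"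
  show "x \<in> diametral_dimension seq_scale (koethe_space a) (koethe_norm a)"
    unfolding mem_diametral_dimension_iff
  proof
    fix p
    obtain q c where q: "q > p" and c: "c > 0"
      and le: "\<And>n j. n \<le> j \<Longrightarrow> a p j \<le> exp (- c * \<epsilon> n) * a q j" using assms by blast
    have "(\<lambda>n. norm (x n) * ball_diameter TYPE('k) n q p) \<longlonglongrightarrow> 0"
    proof (rule tendsto_sandwich[OF _ _ tendsto_const])
      show "(\<lambda>n. norm (x n) * exp (- c * \<epsilon> n)) \<longlonglongrightarrow> 0"
        using x c by (auto simp: subexponential_def)
      show "\<forall>\<^sub>F n in sequentially. 0 \<le> norm (x n) * ball_diameter TYPE('k) n q p"
        by (intro always_eventually allI mult_nonneg_nonneg norm_ge_zero
            kolmogorov_diameter_initial_segment(2)[OF exp_gt_zero le])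
      show "\<forall>\<^sub>F n in sequentially. norm (x n) * ball_diameter TYPE('k) n q p \<le> norm (x n) * exp (- c * \<epsilon> n)"
        by (intro always_eventually allI mult_left_mono norm_ge_zero
            kolmogorov_diameter_initial_segment(1)[OF exp_gt_zero le])
    qed
    then show "\<exists>q>p. (\<lambda>n. norm (x n) * ball_diameter TYPE('k) n q p) \<longlonglongrightarrow> 0" using q by blast
  qed
qed

end

lemma reciprocal_gap_pos: "p < q \<Longrightarrow> 0 < 1 / real (Suc p) - 1 / real (Suc q)"
  by (simp add: frac_less2)

lemma koethe_matrix_Lambda1:
  assumes "exponent_sequence \<alpha>"
  shows "koethe_matrix (\<lambda>p j. exp (- \<alpha> j / real (Suc p)))"
proof
  fix p j
  have "\<alpha> j / real (Suc (Suc p)) \<le> \<alpha> j / real (Suc p)"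
    using assms by (intro divide_left_mono) (auto simp: exponent_sequence_def)
  then show "exp (- \<alpha> j / real (Suc p)) \<le> exp (- \<alpha> j / real (Suc (Suc p)))" by simp
qed simp

lemma koethe_matrix_Lambda_inf:
  assumes "exponent_sequence \<alpha>"
  shows "koethe_matrix (\<lambda>p j. exp (real (Suc p) * \<alpha> j))"
proof
  fix p j
  have "real (Suc p) * \<alpha> j \<le> real (Suc (Suc p)) * \<alpha> j"
    using assms by (intro mult_right_mono) (auto simp: exponent_sequence_def)
  then show "exp (real (Suc p) * \<alpha> j) \<le> exp (real (Suc (Suc p)) * \<alpha> j)" by simp
qed simp

lemma Lambda1_eq_koethe_space: "Lambda1 \<alpha> = koethe_space (\<lambda>p j. exp (- \<alpha> j / real (Suc p)))"
  by (simp add: Lambda1_def koethe_space_def)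

lemma Lambda1_norm_eq_koethe_norm: "Lambda1_norm \<alpha> = koethe_norm (\<lambda>p j. exp (- \<alpha> j / real (Suc p)))"
  by (intro ext) (simp add: Lambda1_norm_def koethe_norm_def)

lemma Lambda_inf_eq_koethe_space: "Lambda_inf \<alpha> = koethe_space (\<lambda>p j. exp (real (Suc p) * \<alpha> j))"
  by (simp add: Lambda_inf_def koethe_space_def)

lemma Lambda_inf_norm_eq_koethe_norm: "Lambda_inf_norm \<alpha> = koethe_norm (\<lambda>p j. exp (real (Suc p) * \<alpha> j))"
  by (intro ext) (simp add: Lambda_inf_norm_def koethe_norm_def)

text \<open>It suffices to test the decay for a sequence of rates that tends to 0.\<close>

lemma subexponentialI:
  fixes x :: "nat \<Rightarrow> 'k::real_normed_field"
  assumes nn: "\<And>n. 0 \<le> \<epsilon> n"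
    and lim: "\<And>p::nat. (\<lambda>n. norm (x n) * exp (- (c / real (Suc p)) * \<epsilon> n)) \<longlonglongrightarrow> 0"
  shows "x \<in> subexponential \<epsilon>"
  unfolding subexponential_def
proof safe
  fix \<delta> :: real assume "\<delta> > 0"
  obtain p :: nat where "real p > c / \<delta>" using reals_Archimedean2 by blast
  then have "c \<le> real (Suc p) * \<delta>" using \<open>\<delta> > 0\<close> by (simp add: field_simps)
  then have p: "c / real (Suc p) \<le> \<delta>" by (simp add: field_simps)
  show "(\<lambda>n. norm (x n) * exp (- \<delta> * \<epsilon> n)) \<longlonglongrightarrow> 0"
  proof (rule tendsto_sandwich[OF _ _ tendsto_const lim[of p]])
    show "\<forall>\<^sub>F n in sequentially. norm (x n) * exp (- \<delta> * \<epsilon> n)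
        \<le> norm (x n) * exp (- (c / real (Suc p)) * \<epsilon> n)"
      using mult_right_mono[OF p nn] by (intro always_eventually allI mult_left_mono) auto
  qed simp
qed

lemma diametral_dimension_Lambda1:
  assumes \<epsilon>: "exponent_sequence \<epsilon>"
  shows "diametral_dimension seq_scale (Lambda1 \<epsilon> :: (nat \<Rightarrow> 'k::real_normed_field) set) (Lambda1_norm \<epsilon>)
    = subexponential \<epsilon>"
proof -
  define a where "a p j = exp (- \<epsilon> j / real (Suc p))" for p j
  interpret koethe_matrix a
    using koethe_matrix_Lambda1[OF \<epsilon>] by (simp add: a_def[abs_def])
  have nn: "0 \<le> \<epsilon> n" and mono: "m \<le> n \<Longrightarrow> \<epsilon> m \<le> \<epsilon> n" for m n
    using \<epsilon> by (auto simp: exponent_sequence_def mono_def)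
  have "diametral_dimension seq_scale (koethe_space a) (koethe_norm a) = (subexponential \<epsilon> :: (nat \<Rightarrow> 'k) set)"
  proof
    show "(subexponential \<epsilon> :: (nat \<Rightarrow> 'k) set) \<subseteq> diametral_dimension seq_scale (koethe_space a) (koethe_norm a)"
    proof (rule subexponential_subset_diametral_dimension)
      fix p
      let ?c = "1 / real (Suc p) - 1 / real (Suc (Suc p))"
      have "a p j \<le> exp (- ?c * \<epsilon> n) * a (Suc p) j" if "n \<le> j" for n j
      proof -
        have "?c * \<epsilon> n \<le> ?c * \<epsilon> j"
          using mono[OF that] reciprocal_gap_pos[of p "Suc p"] by (intro mult_left_mono) auto
        then show ?thesis
          unfolding a_def exp_add[symmetric] by (simp add: algebra_simps)
      qed
      then show "\<exists>q>p. \<exists>c>0. \<forall>n j. n \<le> j \<longrightarrow> a p j \<le> exp (- c * \<epsilon> n) * a q j"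
        using reciprocal_gap_pos[of p "Suc p"] lessI by blast
    qed
    show "diametral_dimension seq_scale (koethe_space a) (koethe_norm a) \<subseteq> (subexponential \<epsilon> :: (nat \<Rightarrow> 'k) set)"
    proof
      fix x :: "nat \<Rightarrow> 'k"
      assume x: "x \<in> diametral_dimension seq_scale (koethe_space a) (koethe_norm a)"
      show "x \<in> subexponential \<epsilon>"
      proof (rule subexponentialI[where c = 1, OF nn])
        fix p
        obtain q where "p < q" and lim: "(\<lambda>n. norm (x n) * ball_diameter TYPE('k) n q p) \<longlonglongrightarrow> 0"
          using x unfolding mem_diametral_dimension_iff by blast
        have "exp (- (1 / real (Suc p)) * \<epsilon> n) \<le> ball_diameter TYPE('k) n q p" for n
        proof (rule le_kolmogorov_diameter[where F = "{..n}"])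
          fix j assume "j \<in> {..n}"
          then have "\<epsilon> j / real (Suc p) \<le> \<epsilon> n / real (Suc p)"
            using mono by (intro divide_right_mono) auto
          moreover have "0 \<le> \<epsilon> j / real (Suc q)" using nn by simp
          ultimately show "exp (- (1 / real (Suc p)) * \<epsilon> n) * a q j \<le> a p j"
            unfolding a_def exp_add[symmetric] exp_le_cancel_iff by (simp only: minus_divide_left times_divide_eq_left mult_minus_left mult_1)
        qed (use \<open>p < q\<close> in auto)
        then show "(\<lambda>n. norm (x n) * exp (- (1 / real (Suc p)) * \<epsilon> n)) \<longlonglongrightarrow> 0"
          by (intro tendsto_sandwich[OF _ _ tendsto_const lim] always_eventually allI mult_left_mono) auto
      qed
    qed
  qed
  then show ?thesis
    unfolding Lambda1_eq_koethe_space Lambda1_norm_eq_koethe_norm a_def[abs_def] .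
qed

lemma subexponential_subset_diametral_dimension_Lambda_inf:
  assumes \<epsilon>: "exponent_sequence \<epsilon>"
  shows "(subexponential \<epsilon> :: (nat \<Rightarrow> 'k::real_normed_field) set)
    \<subseteq> diametral_dimension seq_scale (Lambda_inf \<epsilon>) (Lambda_inf_norm \<epsilon>)"
proof -
  define a where "a p j = exp (real (Suc p) * \<epsilon> j)" for p j
  interpret koethe_matrix a
    using koethe_matrix_Lambda_inf[OF \<epsilon>] by (simp add: a_def[abs_def])
  have "(subexponential \<epsilon> :: (nat \<Rightarrow> 'k) set) \<subseteq> diametral_dimension seq_scale (koethe_space a) (koethe_norm a)"
  proof (rule subexponential_subset_diametral_dimension)
    fix p
    have "a p j \<le> exp (- 1 * \<epsilon> n) * a (Suc p) j" if "n \<le> j" for n j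
    proof -
      have "\<epsilon> n \<le> \<epsilon> j" using \<epsilon> that by (auto simp: exponent_sequence_def mono_def)
      then show ?thesis unfolding a_def exp_add[symmetric] by (simp add: algebra_simps)
    qed
    then show "\<exists>q>p. \<exists>c>0. \<forall>n j. n \<le> j \<longrightarrow> a p j \<le> exp (- c * \<epsilon> n) * a q j"
      using lessI zero_less_one by blast
  qed
  then show ?thesis
    unfolding Lambda_inf_eq_koethe_space Lambda_inf_norm_eq_koethe_norm a_def[abs_def] .
qed

lemma subexponential_eq_Lambda1:
  assumes sum: "\<And>c. c > 0 \<Longrightarrow> summable (\<lambda>n. exp (- c * \<epsilon> n))" and nn: "\<And>n. 0 \<le> \<epsilon> n"
  shows "(subexponential \<epsilon> :: (nat \<Rightarrow> 'k::real_normed_field) set) = Lambda1 \<epsilon>"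
proof
  show "(subexponential \<epsilon> :: (nat \<Rightarrow> 'k) set) \<subseteq> Lambda1 \<epsilon>"
    unfolding Lambda1_def
  proof safe
    fix x :: "nat \<Rightarrow> 'k" and k
    assume x: "x \<in> subexponential \<epsilon>"
    define \<delta> where "\<delta> = 1 / (2 * real (Suc k))"
    have "\<delta> > 0" by (simp add: \<delta>_def)
    then have "(\<lambda>n. norm (x n) * exp (- \<delta> * \<epsilon> n)) \<longlonglongrightarrow> 0" using x by (simp add: subexponential_def)
    then have "\<forall>\<^sub>F n in sequentially. norm (x n) * exp (- \<delta> * \<epsilon> n) < 1"
      by (rule order_tendstoD) simp
    then have "\<forall>\<^sub>F n in sequentially. norm (norm (x n) * exp (- \<epsilon> n / real (Suc k))) \<le> exp (- \<delta> * \<epsilon> n)"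
    proof eventually_elim
      case (elim n)
      have "- \<epsilon> n / real (Suc k) = - \<delta> * \<epsilon> n + - \<delta> * \<epsilon> n"
        by (simp add: \<delta>_def del: of_nat_Suc)
      then have "norm (x n) * exp (- \<epsilon> n / real (Suc k))
          = (norm (x n) * exp (- \<delta> * \<epsilon> n)) * exp (- \<delta> * \<epsilon> n)"
        by (simp only: exp_add mult.assoc)
      also have "\<dots> \<le> 1 * exp (- \<delta> * \<epsilon> n)" using elim by (intro mult_right_mono) auto
      finally show ?case by simp
    qed
    then show "summable (\<lambda>n. norm (x n) * exp (- \<epsilon> n / real (Suc k)))"
      by (rule summable_comparison_test_ev) (rule sum[OF \<open>\<delta> > 0\<close>])
  qed
  show "Lambda1 \<epsilon> \<subseteq> (subexponential \<epsilon> :: (nat \<Rightarrow> 'k) set)"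
  proof
    fix x :: "nat \<Rightarrow> 'k"
    assume "x \<in> Lambda1 \<epsilon>"
    then have "summable (\<lambda>n. norm (x n) * exp (- (1 / real (Suc p)) * \<epsilon> n))" for p
      by (simp add: Lambda1_def)
    then show "x \<in> subexponential \<epsilon>"
      using nn by (intro subexponentialI[where c = 1] summable_LIMSEQ_zero)
  qed
qed

text \<open>
  The counterexample sequences below are supported on the range of a sequence \<open>N\<close> of indices and are
  controlled in terms of the position \<open>k\<close> in that sequence. Only finitely many indices come from
  positions below a given \<open>K\<close>, so convergence in \<open>k\<close> yields convergence in the index.
\<close>

lemma sparse_tendsto_0:
  fixes f :: "nat \<Rightarrow> 'a::real_normed_vector" and N :: "nat \<Rightarrow> nat"
  assumes off: "\<And>n. n \<notin> range N \<Longrightarrow> f n = 0"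
    and small: "\<And>e. e > 0 \<Longrightarrow> \<exists>K. \<forall>k\<ge>K. norm (f (N k)) < e"
  shows "f \<longlonglongrightarrow> 0"
proof (rule LIMSEQ_I)
  fix e :: real assume "e > 0"
  then obtain K where K: "\<And>k. k \<ge> K \<Longrightarrow> norm (f (N k)) < e" using small by blast
  obtain M where M: "\<And>n. n \<in> N ` {..<K} \<Longrightarrow> n < M"
    using finite_nat_set_iff_bounded[of "N ` {..<K}"] by auto
  have "norm (f n - 0) < e" if "n \<ge> M" for n
  proof (cases "n \<in> range N")
    case True
    then obtain k where "n = N k" by blast
    then show ?thesis using M[of n] K[of k] that by (cases "k < K") auto
  qed (use off \<open>e > 0\<close> in simp)
  then show "\<exists>no. \<forall>n\<ge>no. norm (f n - 0) < e" by blast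
qed

text \<open>
  The last condition on an associated exponent sequence. If \<open>\<epsilon>\<close> is at most a multiple of \<open>1 + \<alpha>\<close>, the
  inclusion of the duals is immediate. Otherwise \<open>\<alpha>\<close> is negligible compared with \<open>\<epsilon>\<close> along some
  indices, and there the exponential of the geometric mean \<open>h\<close> of \<open>\<epsilon>\<close> and \<open>1 + \<alpha>\<close> grows subexponentially
  with respect to \<open>\<epsilon>\<close>, but faster than every multiple of \<open>\<alpha>\<close>.
\<close>

lemma subexponential_subset_Lambda_inf_dual:
  assumes \<epsilon>: "exponent_sequence \<epsilon>" and \<alpha>: "exponent_sequence \<alpha>"
    and sub: "(subexponential \<epsilon> :: (nat \<Rightarrow> 'k::real_normed_field) set) \<subseteq> Lambda_inf_dual \<alpha>"
  shows "(Lambda_inf_dual \<epsilon> :: (nat \<Rightarrow> 'k) set) \<subseteq> Lambda_inf_dual \<alpha>"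
proof -
  have \<epsilon>0: "0 \<le> \<epsilon> n" and \<alpha>0: "0 \<le> \<alpha> n" for n using \<epsilon> \<alpha> by (auto simp: exponent_sequence_def)
  have "\<exists>c::nat. \<forall>n. \<epsilon> n \<le> (real c + 1)\<^sup>2 * (1 + \<alpha> n)"
  proof (rule ccontr)
    assume "\<not> ?thesis"
    then have "\<forall>i. \<exists>n. (real i + 1)\<^sup>2 * (1 + \<alpha> n) < \<epsilon> n" by (simp add: not_le)
    then obtain N where N: "\<And>i. (real i + 1)\<^sup>2 * (1 + \<alpha> (N i)) < \<epsilon> (N i)" by metis
    define h where "h n = sqrt (\<epsilon> n * (1 + \<alpha> n))" for n
    define x :: "nat \<Rightarrow> 'k" where "x n = (if n \<in> range N then of_real (exp (h n)) else 0)" for n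
    have h0: "0 \<le> h n" for n using \<epsilon>0 \<alpha>0 by (simp add: h_def)
    have hsq: "h n * h n = \<epsilon> n * (1 + \<alpha> n)" for n using \<epsilon>0[of n] \<alpha>0[of n] by (simp add: h_def)
    have h_le: "(real i + 1) * h (N i) \<le> \<epsilon> (N i)" for i
    proof (rule power2_le_imp_le)
      have "((real i + 1) * h (N i))\<^sup>2 = \<epsilon> (N i) * ((real i + 1)\<^sup>2 * (1 + \<alpha> (N i)))"
        unfolding power_mult_distrib power2_eq_square[of "h (N i)"] hsq by simp
      also have "\<dots> \<le> \<epsilon> (N i) * \<epsilon> (N i)" using N[of i] \<epsilon>0 by (intro mult_left_mono) auto
      finally show "((real i + 1) * h (N i))\<^sup>2 \<le> (\<epsilon> (N i))\<^sup>2" by (simp add: power2_eq_square)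
    qed (rule \<epsilon>0)
    have h_ge: "(real i + 1) * (1 + \<alpha> (N i)) \<le> h (N i)" for i
    proof (rule power2_le_imp_le)
      have "((real i + 1) * (1 + \<alpha> (N i)))\<^sup>2 = ((real i + 1)\<^sup>2 * (1 + \<alpha> (N i))) * (1 + \<alpha> (N i))"
        by (simp add: power2_eq_square)
      also have "\<dots> \<le> \<epsilon> (N i) * (1 + \<alpha> (N i))" using N[of i] \<alpha>0[of "N i"] by (intro mult_right_mono) auto
      finally show "((real i + 1) * (1 + \<alpha> (N i)))\<^sup>2 \<le> (h (N i))\<^sup>2" by (simp add: power2_eq_square hsq)
    qed (rule h0)
    have "x \<in> subexponential \<epsilon>"
      unfolding subexponential_def
    proof safe
      fix \<delta> :: real assume "\<delta> > 0"
      show "(\<lambda>n. norm (x n) * exp (- \<delta> * \<epsilon> n)) \<longlonglongrightarrow> 0"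
      proof (rule sparse_tendsto_0[where N = N])
        fix e :: real assume "e > 0"
        obtain K :: nat where K: "real K > max (2 / \<delta>) (2 / (\<delta> * e))" using reals_Archimedean2 by blast
        have "norm (norm (x (N k)) * exp (- \<delta> * \<epsilon> (N k))) < e" if "k \<ge> K" for k
        proof -
          have k: "2 / \<delta> \<le> real k + 1" "2 / (\<delta> * e) < real k + 1" using K that by linarith+
          have "2 / \<delta> * h (N k) \<le> (real k + 1) * h (N k)" by (intro mult_right_mono k h0)
          also have "\<dots> \<le> \<epsilon> (N k)" by (rule h_le)
          finally have "h (N k) \<le> \<delta> / 2 * \<epsilon> (N k)" using \<open>\<delta> > 0\<close> by (simp add: field_simps)
          then have "norm (norm (x (N k)) * exp (- \<delta> * \<epsilon> (N k))) \<le> exp (- (\<delta> / 2 * \<epsilon> (N k)))"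
            by (simp add: x_def exp_add[symmetric])
          also have "\<dots> < e"
          proof -
            have "(real k + 1) * 1 \<le> (real k + 1)\<^sup>2 * (1 + \<alpha> (N k))"
              using \<alpha>0[of "N k"] by (intro mult_mono) (auto simp: power2_eq_square algebra_simps)
            then have "real k + 1 \<le> (real k + 1)\<^sup>2 * (1 + \<alpha> (N k))" by (simp only: mult_1_right)
            from less_trans[OF less_le_trans[OF k(2) this] N[of k]]
            have "2 / (\<delta> * e) < \<epsilon> (N k)" .
            then have "1 / e < \<delta> / 2 * \<epsilon> (N k)" using \<open>\<delta> > 0\<close> \<open>e > 0\<close> by (simp add: field_simps)
            also have "\<dots> \<le> exp (\<delta> / 2 * \<epsilon> (N k))"
              using exp_ge_add_one_self[of "\<delta> / 2 * \<epsilon> (N k)"] by linarith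
            finally show ?thesis using \<open>e > 0\<close> by (simp add: exp_minus field_simps)
          qed
          finally show ?thesis .
        qed
        then show "\<exists>K. \<forall>k\<ge>K. norm (norm (x (N k)) * exp (- \<delta> * \<epsilon> (N k))) < e" by blast
      qed (simp add: x_def)
    qed
    then have "x \<in> Lambda_inf_dual \<alpha>" using sub by (rule rev_subsetD)
    then obtain k where "bdd_above (range (\<lambda>n. norm (x n) * exp (- real (Suc k) * \<alpha> n)))"
      unfolding Lambda_inf_dual_def mem_Collect_eq by (rule exE)
    then obtain M where M: "\<And>n. norm (x n) * exp (- real (Suc k) * \<alpha> n) \<le> M"
      unfolding bdd_above_def by blast
    obtain i :: nat where i: "real i > max (real k) M" using reals_Archimedean2 by blast
    have "real (Suc k) * \<alpha> (N i) \<le> (real i + 1) * \<alpha> (N i)" using i \<alpha>0 by (intro mult_right_mono) auto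
    then have "real i \<le> h (N i) - real (Suc k) * \<alpha> (N i)"
      using h_ge[of i] unfolding distrib_left mult_1_right by linarith
    also have "\<dots> \<le> exp (h (N i) - real (Suc k) * \<alpha> (N i))"
      using exp_ge_add_one_self[of "h (N i) - real (Suc k) * \<alpha> (N i)"] by linarith
    also have "\<dots> = norm (x (N i)) * exp (- real (Suc k) * \<alpha> (N i))"
    proof -
      have "norm (x (N i)) = exp (h (N i))" by (simp add: x_def)
      then show ?thesis by (simp only: exp_add[symmetric] mult_minus_left diff_conv_add_uminus)
    qed
    also have "\<dots> \<le> M" by (rule M)
    finally show False using i by simp
  qed
  then obtain c :: nat where c: "\<And>n. \<epsilon> n \<le> (real c + 1)\<^sup>2 * (1 + \<alpha> n)" by blast
  define b where "b = (c + 1)\<^sup>2"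
  have b: "\<epsilon> n \<le> real b * (1 + \<alpha> n)" for n
    using c[of n] by (simp add: b_def add.commute)
  show ?thesis
    unfolding Lambda_inf_dual_def
  proof safe
    fix t :: "nat \<Rightarrow> 'k" and k
    assume "bdd_above (range (\<lambda>n. norm (t n) * exp (- real (Suc k) * \<epsilon> n)))"
    then obtain M where M: "\<And>n. norm (t n) * exp (- real (Suc k) * \<epsilon> n) \<le> M"
      unfolding bdd_above_def by blast
    define l where "l = Suc k * b"
    have "norm (t n) * exp (- real (Suc l) * \<alpha> n) \<le> exp (real l) * M" for n
    proof -
      have "real (Suc k) * \<epsilon> n \<le> real (Suc k) * (real b * (1 + \<alpha> n))"
        by (intro mult_left_mono b) simp
      also have "\<dots> = real l + real l * \<alpha> n"
        unfolding l_def of_nat_mult by (simp only: distrib_left mult_1_right mult.assoc)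
      also have "\<dots> \<le> real l + real (Suc l) * \<alpha> n"
        using \<alpha>0[of n] by (intro add_left_mono mult_right_mono) auto
      finally have "exp (- real (Suc l) * \<alpha> n) \<le> exp (real l + - real (Suc k) * \<epsilon> n)"
        by (simp only: exp_le_cancel_iff mult_minus_left)
      then have "norm (t n) * exp (- real (Suc l) * \<alpha> n) \<le> norm (t n) * (exp (real l) * exp (- real (Suc k) * \<epsilon> n))"
        unfolding exp_add by (intro mult_left_mono) auto
      also have "\<dots> = exp (real l) * (norm (t n) * exp (- real (Suc k) * \<epsilon> n))" by (simp only: mult_ac)
      also have "\<dots> \<le> exp (real l) * M" by (intro mult_left_mono M) simp
      finally show ?thesis .
    qed
    then have "bdd_above (range (\<lambda>n. norm (t n) * exp (- real (Suc l) * \<alpha> n)))"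
      by (intro bdd_aboveI2)
    then show "\<exists>k. bdd_above (range (\<lambda>n. norm (t n) * exp (- real (Suc k) * \<alpha> n)))" by blast
  qed
qed

section \<open>A nuclear space without prominent bounded sets\<close>

text \<open>
  The integer part of the logarithm of \<open>n + 1\<close> to the base \<open>b\<close>. With base 3, the block \<open>s\<close> is preceded by exactly
  \<open>3 ^ s - 1\<close> indices and has \<open>2 * 3 ^ s\<close> members.
\<close>

definition block :: "nat \<Rightarrow> nat \<Rightarrow> nat" where
  "block b n = (LEAST s. n + 1 < b ^ Suc s)"

lemma block_bounds:
  assumes "2 \<le> b"
  shows "b ^ block b n \<le> n + 1" "n + 1 < b ^ Suc (block b n)"
proof -
  have "n + 1 < 2 ^ Suc n" using less_exp[of "Suc n"] by simp
  also have "2 ^ Suc n \<le> b ^ Suc n" using assms by (intro power_mono) auto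
  finally show "n + 1 < b ^ Suc (block b n)" unfolding block_def by (rule LeastI)
  show "b ^ block b n \<le> n + 1"
  proof (cases "block b n")
    case (Suc s)
    then have "s < block b n" by simp
    then have "\<not> n + 1 < b ^ Suc s" unfolding block_def by (rule not_less_Least)
    then show ?thesis using Suc by simp
  qed simp
qed

lemma le_block_iff:
  assumes "2 \<le> b"
  shows "s \<le> block b n \<longleftrightarrow> b ^ s \<le> n + 1"
proof
  assume "s \<le> block b n"
  then have "b ^ s \<le> b ^ block b n" using assms by (intro power_increasing) auto
  then show "b ^ s \<le> n + 1" using block_bounds(1)[OF assms, of n] by linarith
next
  assume "b ^ s \<le> n + 1"
  then have "b ^ s < b ^ Suc (block b n)" using block_bounds(2)[OF assms, of n] by linarith
  then show "s \<le> block b n" using assms by (simp only: power_strict_increasing_iff less_Suc_eq_le)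
qed

lemma block_eqI:
  assumes "2 \<le> b" "b ^ s \<le> n + 1" "n + 1 < b ^ Suc s"
  shows "block b n = s"
  using le_block_iff[OF assms(1), of s n] le_block_iff[OF assms(1), of "Suc s" n] assms by linarith

abbreviation level :: "nat \<Rightarrow> nat" where "level \<equiv> block 3"

text \<open>
  The kind is constant on the intervals from \<open>2 ^ m - 1\<close> to \<open>2 ^ (m + 1) - 2\<close>, and the decoding of
  pairs makes every value occur for infinitely many \<open>m\<close>. Both are needed: each kind has to occur on
  arbitrarily late and arbitrarily long runs of blocks.
\<close>

definition kind :: "nat \<Rightarrow> nat" where
  "kind s = fst (prod_decode (block 2 s))"

text \<open>
  The jump occurs one norm later in the first half of a block than in its second half.
\<close>

definition jump :: "nat \<Rightarrow> nat" where
  "jump j = kind (level j) + (if j + 1 < 2 * 3 ^ level j then 1 else 0)"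

definition growth :: "nat \<Rightarrow> real" where
  "growth n = 2 ^ level n"

definition slope :: "nat \<Rightarrow> nat \<Rightarrow> real" where
  "slope p j = of_bool (jump j \<le> p) - 1 / real (Suc p)"

definition weight :: "nat \<Rightarrow> nat \<Rightarrow> real" where
  "weight p j = exp (growth j * slope p j)"

lemma kind_windows: "\<exists>s\<ge>M. \<forall>i\<le>2 * k. kind (s + i) = k"
proof -
  define m where "m = prod_encode (k, 2 * k + M + 1)"
  have m: "2 * k + M + 1 \<le> m" unfolding m_def by (rule le_prod_encode_2)
  have large: "2 * k + M + 1 < 2 ^ m" using m less_exp[of m] by linarith
  have "kind (2 ^ m - 1 + i) = k" if "i \<le> 2 * k" for i
  proof -
    have "block 2 (2 ^ m - 1 + i) = m"
      using large that by (intro block_eqI) auto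
    then show ?thesis by (simp add: kind_def m_def)
  qed
  then show ?thesis using large by (intro exI[of _ "2 ^ m - 1"]) auto
qed

lemma level_mono: "m \<le> n \<Longrightarrow> level m \<le> level n"
  using le_block_iff[of 3 "level m" n] block_bounds(1)[of 3 m] by simp

lemma growth_ge_1: "1 \<le> growth n"
  by (simp add: growth_def)

lemma growth_mono: "m \<le> n \<Longrightarrow> growth m \<le> growth n"
  unfolding growth_def by (intro power_increasing level_mono) auto

text \<open>
  Fewer than \<open>3 ^ (s + 1)\<close> indices precede the end of block \<open>s\<close>, and \<open>3 ^ (s + 1) \<le> 4 * (2 ^ s)\<^sup>2\<close>. So
  the exponents grow at least like a square root, which makes the space nuclear.
\<close>

lemma growth_quadratic: "real n + 1 \<le> 4 * (growth n)\<^sup>2"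
proof -
  have "n + 1 < 4 ^ Suc (level n)"
    using block_bounds(2)[of 3 n] power_mono[of "3::nat" 4 "Suc (level n)"] by linarith
  then have "real (n + 1) < real (4 ^ Suc (level n))" by (simp only: of_nat_less_iff)
  also have "\<dots> = 4 * (growth n)\<^sup>2"
    by (simp add: growth_def power_mult_distrib[symmetric] power2_eq_square)
  finally show ?thesis by simp
qed

lemma exponent_sequence_growth: "exponent_sequence growth"
  unfolding exponent_sequence_def
proof (intro conjI allI)
  show "0 \<le> growth n" for n using growth_ge_1[of n] by linarith
  show "mono growth" by (rule monoI) (rule growth_mono)
  show "filterlim growth at_top sequentially"
    unfolding filterlim_at_top
  proof
    fix Z :: real
    obtain m :: nat where m: "Z < real m" using reals_Archimedean2 by blast
    have "Z \<le> growth n" if "n \<ge> 3 ^ m" for n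
    proof -
      have "m \<le> level n" using le_block_iff[of 3 m n] that by simp
      then have "m < 2 ^ level n" using less_exp[of "level n"] by linarith
      then have "real m < growth n" unfolding growth_def by (simp add: of_nat_less_iff[symmetric] del: of_nat_less_iff)
      then show ?thesis using m by linarith
    qed
    then show "\<forall>\<^sub>F n in sequentially. Z \<le> growth n"
      unfolding eventually_sequentially by blast
  qed
qed

lemma summable_exp_growth:
  assumes "c > 0"
  shows "summable (\<lambda>n. exp (- c * growth n))"
proof (rule summable_comparison_test'[of _ 0])
  show "summable (\<lambda>n. 4096 / c ^ 4 * inverse ((real (n + 1))\<^sup>2))"
    using inverse_squares_sums by (intro summable_mult) (auto simp: sums_iff inverse_eq_divide add.commute)
  fix n
  let ?y = "c * growth n"
  have y: "?y > 0" using assms growth_ge_1[of n] by simp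
  \<comment> \<open>The fourth power is the square of growth squared, hence beats the square of n.\<close>
  have "(?y / 4) ^ 4 \<le> exp (?y / 4) ^ 4"
    using y exp_ge_add_one_self[of "?y / 4"] by (intro power_mono) linarith+
  also have "\<dots> = exp ?y" using exp_of_nat_mult[of 4 "?y / 4"] by simp
  finally have "?y ^ 4 / 256 \<le> exp ?y" by (simp add: power_divide)
  then have "exp (- ?y) \<le> 256 / ?y ^ 4"
    using le_imp_inverse_le[of "?y ^ 4 / 256" "exp ?y"] zero_less_power[OF y, of 4]
    unfolding exp_minus inverse_divide by linarith
  also have "\<dots> = 4096 / c ^ 4 * inverse ((4 * (growth n)\<^sup>2)\<^sup>2)"
    by (simp add: power_mult_distrib field_simps flip: power_mult)
  also have "\<dots> \<le> 4096 / c ^ 4 * inverse ((real (n + 1))\<^sup>2)"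
    using growth_quadratic[of n] assms by (intro mult_left_mono le_imp_inverse_le power_mono) auto
  finally show "norm (exp (- c * growth n)) \<le> 4096 / c ^ 4 * inverse ((real (n + 1))\<^sup>2)" by simp
qed

lemma slope_diff_ge:
  assumes "p \<le> q"
  shows "1 / real (Suc p) - 1 / real (Suc q) \<le> slope q j - slope p j"
  using assms by (simp add: slope_def)

interpretation example: koethe_matrix weight
proof
  fix p j
  have "slope p j \<le> slope (Suc p) j"
    using slope_diff_ge[of p "Suc p" j] reciprocal_gap_pos[of p "Suc p"] by linarith
  then show "weight p j \<le> weight (Suc p) j"
    unfolding weight_def using growth_ge_1[of j] by simp
qed (simp add: weight_def)

text \<open>
  A jump only helps this estimate, which is therefore the one for a power series space of finite
  type with exponents \<open>growth\<close>.
\<close>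

lemma weight_quotient_le:
  assumes "p < q" "n \<le> j"
  shows "weight p j \<le> exp (- (1 / real (Suc p) - 1 / real (Suc q)) * growth n) * weight q j"
proof -
  have "(1 / real (Suc p) - 1 / real (Suc q)) * growth n \<le> (slope q j - slope p j) * growth j"
    using slope_diff_ge[of p q j] reciprocal_gap_pos[OF assms(1)] assms growth_mono[OF assms(2)] growth_ge_1[of n]
    by (intro mult_mono) auto
  then show ?thesis
    unfolding weight_def exp_add[symmetric] by (simp add: algebra_simps)
qed

lemma example_nuclear:
  "nuclear_space seq_scale (koethe_space weight :: (nat \<Rightarrow> 'k::real_normed_field) set) (koethe_norm weight)"
proof (rule example.koethe_nuclear)
  fix p
  define c where "c = 1 / real (Suc p) - 1 / real (Suc (Suc p))"
  have "c > 0" unfolding c_def by (rule reciprocal_gap_pos) simp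
  have "summable (\<lambda>j. weight p j / weight (Suc p) j)"
  proof (rule summable_comparison_test'[OF summable_exp_growth[OF \<open>c > 0\<close>], of 0])
    fix j
    show "norm (weight p j / weight (Suc p) j) \<le> exp (- c * growth j)"
      using weight_quotient_le[of p "Suc p" j j] example.weight_pos[of p j] example.weight_pos[of "Suc p" j]
      unfolding c_def[symmetric] by (simp add: pos_divide_le_eq)
  qed
  then show "\<exists>q\<ge>p. summable (\<lambda>j. weight p j / weight q j)" by (intro exI[of _ "Suc p"]) auto
qed

lemma weight_powr: "weight p j powr r = exp (growth j * (r * slope p j))"
  by (simp add: weight_def powr_def)

text \<open>
  The jump part of the weight is increasing in the norm and at most 1, so it passes from \<open>j\<close> to \<open>l\<close> at
  a loss of order \<open>lam\<close>. With \<open>l + 1 = 2 * (j + 1)\<close> the reciprocals leave room \<open>1 / (2 * (j + 1))\<close> for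
  this loss, which accounts for the choice of \<open>lam\<close>.
\<close>

lemma example_DN:
  "DN_property (koethe_space weight :: (nat \<Rightarrow> 'k::real_normed_field) set) (koethe_norm weight)"
proof (rule example.koethe_DN[where k = 0])
  fix j
  define P where "P = real (Suc j)"
  define lam where "lam = 1 / (4 * P)"
  have P: "P \<ge> 1" by (simp add: P_def)
  have lam: "0 < lam" "lam < 1" using P by (auto simp: lam_def field_simps)
  have slope: "slope j i \<le> lam * slope 0 i + (1 - lam) * slope (2 * j + 1) i" for i
  proof -
    let ?b = "of_bool (jump i \<le> j) :: real"
    have 0: "- 1 \<le> slope 0 i" by (simp add: slope_def)
    have l: "?b - 1 / (2 * P) \<le> slope (2 * j + 1) i" by (simp add: slope_def P_def)
    have "1 / P = 2 * lam + 1 / (2 * P)" using P by (simp add: lam_def)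
    then have "slope j i = ?b - 2 * lam - 1 / (2 * P)" unfolding slope_def P_def[symmetric] by simp
    also have "\<dots> \<le> lam * (- 1) + (1 - lam) * (?b - 1 / (2 * P))"
    proof -
      have "lam * ?b \<le> lam * 1" "0 \<le> lam * (1 / (2 * P))" using lam P by (auto intro!: mult_left_mono)
      then show ?thesis by (simp only: left_diff_distrib right_diff_distrib mult_1)
    qed
    also have "\<dots> \<le> lam * slope 0 i + (1 - lam) * slope (2 * j + 1) i"
      using lam 0 l by (intro add_mono mult_left_mono) auto
    finally show ?thesis .
  qed
  have "weight j i \<le> weight 0 i powr lam * weight (2 * j + 1) i powr (1 - lam)" for i
    unfolding weight_powr exp_add[symmetric] distrib_left[symmetric] unfolding weight_def exp_le_cancel_iff
    using growth_ge_1[of i] by (intro mult_left_mono slope) auto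
  then show "\<exists>l lam. 0 < lam \<and> lam < 1 \<and> (\<forall>i. weight j i \<le> weight 0 i powr lam * weight l i powr (1 - lam))"
    using lam by blast
qed

text \<open>
  The next norm \<open>p + 1\<close> can be chosen as \<open>q\<close>, for all \<open>k\<close> with the same \<open>\<theta>\<close>, because slopes never
  exceed 1: before and after the jump, the difference of the reciprocals of \<open>p + 1\<close> and \<open>p + 2\<close>
  pays for \<open>\<theta>\<close>, and at an index that jumps exactly at \<open>p + 1\<close> the jump does.
\<close>

lemma example_Omega:
  "Omega_property seq_scale (koethe_space weight :: (nat \<Rightarrow> 'k::real_normed_field) set) (koethe_norm weight)"
proof (rule example.koethe_Omega)
  fix p
  define P where "P = real (Suc p)"
  define \<theta> where "\<theta> = 1 / (P + 1)\<^sup>2"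
  have P: "P \<ge> 1" by (simp add: P_def)
  have \<theta>: "0 < \<theta>" "\<theta> \<le> 1 / 4"
    using P power_mono[of 2 "P + 1" 2] by (auto simp: \<theta>_def divide_simps)
  have \<theta>P: "\<theta> * (P + 1) = 1 / (P + 1)" using P by (simp add: \<theta>_def power2_eq_square)
  have half: "1 / (P + 1) \<le> 1 / 2" using P by (simp add: field_simps)
  have frac: "1 / P - 1 / (P + 1) = 1 / (P + 1) * (1 / P)" using P by (simp add: field_simps)
  have slope: "(1 - \<theta>) * slope p i + \<theta> * slope k i \<le> slope (Suc p) i" for i k
  proof -
    have q: "slope (Suc p) i = of_bool (jump i \<le> Suc p) - 1 / (P + 1)" by (simp add: slope_def P_def add.commute)
    have sp: "slope p i = of_bool (jump i \<le> p) - 1 / P" by (simp add: slope_def P_def)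
    have "0 \<le> 1 / real (Suc k)" "of_bool (jump i \<le> k) \<le> (1 :: real)" by simp_all
    then have "slope k i \<le> 1" unfolding slope_def by linarith
    then have k: "\<theta> * slope k i \<le> \<theta>" using \<theta> by simp
    have gap: "\<theta> + \<theta> / P \<le> 1 / P - 1 / (P + 1)"
    proof -
      have "\<theta> + \<theta> / P = \<theta> * (P + 1) * (1 / P)" using P by (simp add: field_simps)
      then show ?thesis unfolding \<theta>P frac by simp
    qed
    have \<theta>': "0 \<le> \<theta> / P" "0 \<le> 1 / P" using \<theta> P by auto
    have expand: "(1 - \<theta>) * (b - 1 / P) = b - 1 / P - \<theta> * b + \<theta> / P" for b
      by (simp add: algebra_simps diff_divide_distrib)
    consider "jump i \<le> p" | "jump i = Suc p" | "jump i > Suc p" by linarith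
    then show ?thesis
    proof cases
      case 1
      then have b: "of_bool (jump i \<le> p) = (1 :: real)" "of_bool (jump i \<le> Suc p) = (1 :: real)" by auto
      show ?thesis unfolding q sp expand b using k gap \<theta> \<theta>' by linarith
    next
      case 2
      then have b: "of_bool (jump i \<le> p) = (0 :: real)" "of_bool (jump i \<le> Suc p) = (1 :: real)" by auto
      show ?thesis unfolding q sp expand b mult_zero_right using k gap \<theta> \<theta>' half by linarith
    next
      case 3
      then have b: "of_bool (jump i \<le> p) = (0 :: real)" "of_bool (jump i \<le> Suc p) = (0 :: real)" by auto
      show ?thesis unfolding q sp expand b mult_zero_right using k gap \<theta> \<theta>' by linarith
    qed
  qed
  have "weight p i powr (1 - \<theta>) * weight k i powr \<theta> \<le> weight (Suc p) i" for i k
    unfolding weight_powr exp_add[symmetric] distrib_left[symmetric] unfolding weight_def exp_le_cancel_iff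
    using growth_ge_1[of i] by (intro mult_left_mono slope) auto
  then show "\<exists>q. \<forall>k. \<exists>\<theta>. 0 < \<theta> \<and> \<theta> < 1 \<and> (\<forall>i. weight p i powr (1 - \<theta>) * weight k i powr \<theta> \<le> weight q i)"
    using \<theta> by (intro exI[of _ "Suc p"] allI exI[of _ \<theta>]) auto
qed

text \<open>
  The block after the one that contains \<open>n\<close> has kind \<open>k = kind (Suc (level n))\<close>. Its first half jumps at \<open>k + 1\<close>, so
  not between \<open>p\<close> and \<open>q\<close> if \<open>q \<le> k\<close>; its second half jumps at \<open>k\<close>, so not between \<open>p\<close> and \<open>q\<close> if
  \<open>k \<le> p\<close>. Each half has more than \<open>n\<close> members. The factor 2 in the exponent is the price for going
  to the next block.
\<close>

lemma example_diameter_ge: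
  assumes "p < q" and k: "q \<le> kind (Suc (level n)) \<or> kind (Suc (level n)) \<le> p"
  shows "exp (- (2 / real (Suc p)) * growth n) \<le> example.ball_diameter TYPE('k::real_normed_field) n q p"
proof -
  define s where "s = Suc (level n)"
  define F :: "nat set" where "F = (if q \<le> kind s then {3 ^ s - 1..<2 * 3 ^ s - 1} else {2 * 3 ^ s - 1..<3 * 3 ^ s - 1})"
  have pow: "(1::nat) \<le> 3 ^ s" by simp
  have n: "n + 1 < 3 ^ s" using block_bounds(2)[of 3 n] by (simp add: s_def)
  have card: "card F = 3 ^ s" using pow by (simp add: F_def)
  have F: "level j = s \<and> (jump j \<le> p \<longleftrightarrow> jump j \<le> q)" if "j \<in> F" for j
  proof -
    have "3 ^ s \<le> j + 1" "j + 1 < 3 ^ Suc s" using that pow by (auto simp: F_def split: if_splits)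
    then have level: "level j = s" by (intro block_eqI) auto
    show ?thesis
    proof (cases "q \<le> kind s")
      case True
      then have "j + 1 < 2 * 3 ^ s" using that pow by (auto simp: F_def)
      then have "jump j = kind s + 1" by (simp add: jump_def level)
      then show ?thesis using True \<open>p < q\<close> level by simp
    next
      case False
      then have "\<not> j + 1 < 2 * 3 ^ s" using that pow by (auto simp: F_def)
      then have "jump j = kind s" by (simp add: jump_def level)
      then show ?thesis using k False \<open>p < q\<close> level by (simp add: s_def)
    qed
  qed
  show ?thesis
  proof (rule example.le_kolmogorov_diameter[where F = F])
    show "p \<le> q" using assms by simp
    show "finite F" by (simp add: F_def)
    show "n < card F" using card n by simp
    fix j assume "j \<in> F"
    then have g: "growth j = 2 * growth n" and "slope q j \<le> slope p j + 1 / real (Suc p)"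
      using F[of j] by (auto simp: growth_def s_def slope_def)
    then have "growth j * slope q j \<le> growth j * (slope p j + 1 / real (Suc p))"
      using growth_ge_1[of j] by (intro mult_left_mono) auto
    then show "exp (- (2 / real (Suc p)) * growth n) * weight q j \<le> weight p j"
      unfolding weight_def exp_add[symmetric] g by (simp add: distrib_left)
  qed
qed

text \<open>
  For the inclusion into the subexponential sequences, \<open>q\<close> is obtained from \<open>p\<close>, and then \<open>r\<close> from
  \<open>q\<close>. For each \<open>n\<close> the relevant kind is at least \<open>q\<close> or at most \<open>q\<close>, so at least one of the
  pairs \<open>(p, q)\<close> and \<open>(q, r)\<close> satisfies the hypothesis of the preceding lemma.
\<close>

lemma example_diametral_dimension:
  "diametral_dimension seq_scale (koethe_space weight :: (nat \<Rightarrow> 'k::real_normed_field) set) (koethe_norm weight)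
    = subexponential growth"
proof
  show "(subexponential growth :: (nat \<Rightarrow> 'k) set)
      \<subseteq> diametral_dimension seq_scale (koethe_space weight) (koethe_norm weight)"
  proof (rule example.subexponential_subset_diametral_dimension)
    fix p
    show "\<exists>q>p. \<exists>c>0. \<forall>n j. n \<le> j \<longrightarrow> weight p j \<le> exp (- c * growth n) * weight q j"
      by (rule exI[of _ "Suc p"], rule conjI[OF lessI],
          rule exI[of _ "1 / real (Suc p) - 1 / real (Suc (Suc p))"])
         (intro conjI allI impI reciprocal_gap_pos weight_quotient_le lessI)
  qed
  show "diametral_dimension seq_scale (koethe_space weight) (koethe_norm weight)
      \<subseteq> (subexponential growth :: (nat \<Rightarrow> 'k) set)"
  proof
    fix x :: "nat \<Rightarrow> 'k"
    assume x: "x \<in> diametral_dimension seq_scale (koethe_space weight) (koethe_norm weight)"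
    let ?d = "example.ball_diameter TYPE('k)"
    have lim: "\<exists>q>p. (\<lambda>n. norm (x n) * ?d n q p) \<longlonglongrightarrow> 0" for p
      using x unfolding example.mem_diametral_dimension_iff by (rule spec)
    show "x \<in> subexponential growth"
    proof (rule subexponentialI[where c = 2])
      show "0 \<le> growth n" for n using growth_ge_1[of n] by linarith
      fix p
      obtain q where q: "p < q" and lim_q: "(\<lambda>n. norm (x n) * ?d n q p) \<longlonglongrightarrow> 0"
        using lim[of p] by blast
      obtain r where r: "q < r" and lim_r: "(\<lambda>n. norm (x n) * ?d n r q) \<longlonglongrightarrow> 0"
        using lim[of q] by blast
      have "exp (- (2 / real (Suc p)) * growth n) \<le> ?d n q p + ?d n r q" for n
      proof (cases "q \<le> kind (Suc (level n))")
        case True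
        then have "exp (- (2 / real (Suc p)) * growth n) \<le> ?d n q p"
          using q by (intro example_diameter_ge) auto
        also have "\<dots> \<le> ?d n q p + ?d n r q" using r by (simp add: example.ball_diameter_nonneg)
        finally show ?thesis .
      next
        case False
        have "2 / real (Suc q) \<le> 2 / real (Suc p)" using q by (intro divide_left_mono) auto
        then have "2 / real (Suc q) * growth n \<le> 2 / real (Suc p) * growth n"
          using growth_ge_1[of n] by (intro mult_right_mono) auto
        then have "exp (- (2 / real (Suc p)) * growth n) \<le> exp (- (2 / real (Suc q)) * growth n)"
          by (simp only: exp_le_cancel_iff mult_minus_left neg_le_iff_le)
        also have "\<dots> \<le> ?d n r q" using False r by (intro example_diameter_ge) auto
        also have "\<dots> \<le> ?d n q p + ?d n r q" using q by (simp add: example.ball_diameter_nonneg)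
        finally show ?thesis .
      qed
      then have le: "norm (x n) * exp (- (2 / real (Suc p)) * growth n) \<le> norm (x n) * ?d n q p + norm (x n) * ?d n r q" for n
        unfolding distrib_left[symmetric] by (rule mult_left_mono[OF _ norm_ge_zero])
      have "(\<lambda>n. norm (x n) * ?d n q p + norm (x n) * ?d n r q) \<longlonglongrightarrow> 0"
        using tendsto_add[OF lim_q lim_r] by simp
      then show "(\<lambda>n. norm (x n) * exp (- (2 / real (Suc p)) * growth n)) \<longlonglongrightarrow> 0"
        by (rule tendsto_sandwich[OF _ _ tendsto_const, rotated 2])
           (intro always_eventually allI le mult_nonneg_nonneg norm_ge_zero exp_ge_zero)+
    qed
  qed
qed

text \<open>
  Suppose that all blocks from \<open>s\<close> to \<open>s + 2 * k\<close> have kind \<open>k\<close>. In these blocks every index jumps between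
  \<open>p < k\<close> and \<open>k + 1\<close>. In later blocks a jump cannot be relied upon, but there the exponents exceed
  \<open>2 ^ s\<close> by the factor \<open>2 ^ (2 * k + 1)\<close>, which outweighs the smallest possible difference of the
  reciprocals, \<open>1 / ((k + 1) * (k + 2))\<close>. So long runs of blocks of the same kind make the
  lower bound independent of \<open>p\<close>.
\<close>

lemma growth_slope_in_window:
  assumes "p < k" and window: "\<And>i. i \<le> 2 * k \<Longrightarrow> kind (s + i) = k" and "s \<le> level j"
  shows "2 ^ s \<le> growth j * (slope (Suc k) j - slope p j)"
proof (cases "level j \<le> s + 2 * k")
  case True
  then have "kind (level j) = k" using window[of "level j - s"] \<open>s \<le> level j\<close> by simp
  then have "p < jump j" "jump j \<le> Suc k" using \<open>p < k\<close> by (auto simp: jump_def)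
  then have "slope (Suc k) j - slope p j = 1 + (1 / real (Suc p) - 1 / real (Suc (Suc k)))"
    by (simp add: slope_def)
  then have "1 \<le> slope (Suc k) j - slope p j"
    using reciprocal_gap_pos[of p "Suc k"] \<open>p < k\<close> by simp
  moreover have "(2::real) ^ s \<le> growth j"
    unfolding growth_def using \<open>s \<le> level j\<close> by (intro power_increasing) auto
  ultimately have "2 ^ s * 1 \<le> growth j * (slope (Suc k) j - slope p j)"
    using growth_ge_1[of j] by (intro mult_mono) auto
  then show ?thesis by simp
next
  case False
  have "real (Suc k) * real (Suc (Suc k)) \<le> 2 ^ k * 2 ^ Suc k"
  proof (intro mult_mono)
    have *: "Suc m \<le> 2 ^ m" for m :: nat using less_exp[of m] by (simp add: Suc_le_eq)
    show "real (Suc k) \<le> 2 ^ k" using of_nat_mono[OF *[of k], where 'a = real] by simp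
    show "real (Suc (Suc k)) \<le> 2 ^ Suc k" using of_nat_mono[OF *[of "Suc k"], where 'a = real] by simp
  qed auto
  also have "(2::real) ^ k * 2 ^ Suc k = 2 ^ (k + Suc k)" by (simp only: power_add)
  also have "k + Suc k = 2 * k + 1" by simp
  finally have prod: "real (Suc k) * real (Suc (Suc k)) \<le> 2 ^ (2 * k + 1)" .
  have "1 / (real (Suc k) * real (Suc (Suc k))) = 1 / real (Suc k) - 1 / real (Suc (Suc k))"
    by (simp add: field_simps)
  also have "\<dots> \<le> 1 / real (Suc p) - 1 / real (Suc (Suc k))"
    using \<open>p < k\<close> by (intro diff_right_mono divide_left_mono) auto
  also have "\<dots> \<le> slope (Suc k) j - slope p j" using \<open>p < k\<close> by (intro slope_diff_ge) simp
  finally have slope: "1 / (real (Suc k) * real (Suc (Suc k))) \<le> slope (Suc k) j - slope p j" .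
  have "(2::real) ^ s = (2 ^ s * (real (Suc k) * real (Suc (Suc k)))) * (1 / (real (Suc k) * real (Suc (Suc k))))"
    by simp
  also have "\<dots> \<le> (2 ^ s * 2 ^ (2 * k + 1)) * (slope (Suc k) j - slope p j)"
    by (intro mult_mono slope prod) auto
  also have "\<dots> = 2 ^ (s + (2 * k + 1)) * (slope (Suc k) j - slope p j)"
    by (simp only: power_add)
  also have "\<dots> \<le> growth j * (slope (Suc k) j - slope p j)"
  proof (rule mult_right_mono)
    show "2 ^ (s + (2 * k + 1)) \<le> growth j"
      unfolding growth_def using False by (intro power_increasing) auto
    show "0 \<le> slope (Suc k) j - slope p j"
      using order_trans[OF _ slope, of 0] by simp
  qed
  finally show ?thesis .
qed

text \<open>
  For each \<open>k\<close> the run of blocks of kind \<open>k\<close> is taken so late that half of the gain \<open>2 ^ S k\<close> absorbs the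
  bound \<open>C (k + 1)\<close> of \<open>B\<close> with respect to the norm \<open>k + 1\<close>. The index \<open>N k\<close> is the first one of the
  run; the earlier indices, exactly \<open>N k\<close> in number, span the approximating subspace.
\<close>

lemma example_no_prominent_bounded_set:
  "\<not> prominent_bounded_set seq_scale (koethe_space weight :: (nat \<Rightarrow> 'k::real_normed_field) set) (koethe_norm weight) B"
proof
  assume prominent: "prominent_bounded_set seq_scale (koethe_space weight) (koethe_norm weight) B"
  let ?E = "koethe_space weight :: (nat \<Rightarrow> 'k) set"
  have BE: "B \<subseteq> ?E" and bdd: "\<And>q. bdd_above (koethe_norm weight q ` B)"
    using prominent unfolding prominent_bounded_set_def bounded_set_def by auto
  have "\<exists>C>0. \<forall>x\<in>B. koethe_norm weight q x \<le> C" for q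
  proof -
    obtain M where "\<And>x. x \<in> B \<Longrightarrow> koethe_norm weight q x \<le> M"
      using bdd[of q] by (auto simp: bdd_above_def)
    then show ?thesis by (intro exI[of _ "max 1 M"]) fastforce
  qed
  then obtain C where C0: "\<And>q. C q > 0" and C: "\<And>q x. x \<in> B \<Longrightarrow> koethe_norm weight q x \<le> C q" by metis
  have "\<exists>s\<ge>k. (\<forall>i\<le>2 * k. kind (s + i) = k) \<and> C (Suc k) \<le> exp (2 ^ s / 2)" for k
  proof -
    obtain m :: nat where m: "2 * C (Suc k) < real m" using reals_Archimedean2 by blast
    obtain s where s: "s \<ge> max k m" "\<forall>i\<le>2 * k. kind (s + i) = k" using kind_windows by blast
    have "real m \<le> real s" using s by simp
    also have "\<dots> \<le> 2 ^ s" using of_nat_mono[OF less_imp_le[OF less_exp[of s]], where 'a = real] by simp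
    finally have "C (Suc k) \<le> 2 ^ s / 2" using m by linarith
    also have "\<dots> \<le> exp (2 ^ s / 2)" using exp_ge_add_one_self[of "2 ^ s / 2 :: real"] by linarith
    finally show ?thesis using s by auto
  qed
  then obtain S where Sk: "\<And>k. k \<le> S k" and window: "\<And>k i. i \<le> 2 * k \<Longrightarrow> kind (S k + i) = k"
    and CS: "\<And>k. C (Suc k) \<le> exp (2 ^ S k / 2)" by metis
  define N where "N k = (3 ^ S k - 1 :: nat)" for k
  have N1: "N k + 1 = 3 ^ S k" for k by (simp add: N_def)
  have level_N: "level (N k) = S k" for k by (rule block_eqI) (simp_all only: N1, simp_all)
  have growth_N: "growth (N k) = 2 ^ S k" for k by (simp add: growth_def level_N)
  have growth_N_ge: "real k \<le> growth (N k)" for k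
  proof -
    have "real k \<le> real (2 ^ S k)"
      using Sk[of k] less_exp[of "S k"] by (simp only: of_nat_le_iff)
    then show ?thesis by (simp add: growth_N)
  qed
  let ?d = "\<lambda>p n. kolmogorov_diameter seq_scale ?E n B (unit_ball ?E (koethe_norm weight p))"
  have d: "0 \<le> ?d p (N k) \<and> ?d p (N k) \<le> exp (- growth (N k) / 2)" if "p < k" for p k
  proof -
    have "C (Suc k) * weight p j \<le> exp (- growth (N k) / 2) * weight (Suc k) j" if "j \<notin> {..<N k}" for j
    proof -
      have "S k \<le> level j" using that level_mono[of "N k" j] by (simp add: level_N)
      then have "growth (N k) \<le> growth j * (slope (Suc k) j - slope p j)"
        unfolding growth_N by (intro growth_slope_in_window \<open>p < k\<close> window)
      then have "growth (N k) / 2 + growth j * slope p j \<le> - growth (N k) / 2 + growth j * slope (Suc k) j"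
        by (simp add: right_diff_distrib)
      then have "exp (growth (N k) / 2) * weight p j \<le> exp (- growth (N k) / 2) * weight (Suc k) j"
        unfolding weight_def exp_add[symmetric] exp_le_cancel_iff .
      moreover have "C (Suc k) * weight p j \<le> exp (growth (N k) / 2) * weight p j"
        using CS[of k] unfolding growth_N by (intro mult_right_mono example.weight_nonneg)
      ultimately show ?thesis by linarith
    qed
    then show ?thesis
      using example.kolmogorov_diameter_le[of B "Suc k" "C (Suc k)" "exp (- growth (N k) / 2)" "{..<N k}" "N k" p]
        BE C C0 by auto
  qed
  define x :: "nat \<Rightarrow> 'k" where "x n = (if n \<in> range N then of_real (exp (growth n / 4)) else 0)" for n
  have "(\<lambda>n. x n * of_real (?d p n)) \<longlonglongrightarrow> 0" for p
  proof (rule sparse_tendsto_0[where N = N])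
    fix e :: real assume "e > 0"
    obtain K :: nat where K: "real K > 4 / e" using reals_Archimedean2 by blast
    have "norm (x (N k) * of_real (?d p (N k))) < e" if "k \<ge> K + Suc p" for k
    proof -
      have "norm (x (N k) * of_real (?d p (N k))) = exp (growth (N k) / 4) * ?d p (N k)"
        using d[of p k] that by (simp add: x_def norm_mult)
      also have "\<dots> \<le> exp (growth (N k) / 4) * exp (- growth (N k) / 2)"
        using d[of p k] that by (intro mult_left_mono) auto
      also have "\<dots> = exp (- (growth (N k) / 4))" by (simp add: exp_add[symmetric])
      also have "\<dots> < e"
      proof -
        have "4 / e < growth (N k)" using K that growth_N_ge[of k] by linarith
        then have "1 / e < growth (N k) / 4" using \<open>e > 0\<close> by (simp add: field_simps)
        also have "\<dots> \<le> exp (growth (N k) / 4)" using exp_ge_add_one_self[of "growth (N k) / 4"] by linarith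
        finally show ?thesis using \<open>e > 0\<close> by (simp add: exp_minus field_simps)
      qed
      finally show ?thesis .
    qed
    then show "\<exists>K. \<forall>k\<ge>K. norm (x (N k) * of_real (?d p (N k))) < e" by blast
  qed (simp add: x_def)
  then have "x \<in> diametral_dimension seq_scale ?E (koethe_norm weight)"
    using prominent unfolding prominent_bounded_set_def by blast
  then have "x \<in> subexponential growth" by (simp only: example_diametral_dimension)
  then have lim: "(\<lambda>n. norm (x n) * exp (- \<delta> * growth n)) \<longlonglongrightarrow> 0" if "\<delta> > 0" for \<delta>
    using that unfolding subexponential_def by blast
  have "(\<lambda>n. norm (x n) * exp (- (1 / 8) * growth n)) \<longlonglongrightarrow> 0" by (rule lim) simp
  then have "\<forall>\<^sub>F n in sequentially. norm (x n) * exp (- (1 / 8) * growth n) < 1"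
    by (rule order_tendstoD) simp
  then obtain M where M: "\<And>n. n \<ge> M \<Longrightarrow> norm (x n) * exp (- (1 / 8) * growth n) < 1"
    unfolding eventually_sequentially by blast
  have "M \<le> N M"
  proof -
    have "M < 3 ^ S M"
      using Sk[of M] less_exp[of "S M"] power_mono[of "2::nat" 3 "S M"] by linarith
    then show ?thesis by (simp add: N_def)
  qed
  then have "norm (x (N M)) * exp (- (1 / 8) * growth (N M)) < 1" by (rule M)
  then have "exp (growth (N M) / 8) < 1" by (simp add: x_def exp_add[symmetric])
  then show False using growth_ge_1[of "N M"] by simp
qed

lemma example_associated_exponent_sequence:
  "associated_exponent_sequence seq_scale (koethe_space weight :: (nat \<Rightarrow> 'k::real_normed_field) set)
     (koethe_norm weight) growth"
  unfolding associated_exponent_sequence_def example_diametral_dimension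
    diametral_dimension_Lambda1[OF exponent_sequence_growth]
proof (intro conjI allI impI)
  show "exponent_sequence growth" by (rule exponent_sequence_growth)
  show "(subexponential growth :: (nat \<Rightarrow> 'k) set)
      \<subseteq> diametral_dimension seq_scale (Lambda_inf growth) (Lambda_inf_norm growth)"
    by (rule subexponential_subset_diametral_dimension_Lambda_inf[OF exponent_sequence_growth])
  fix \<alpha> assume \<alpha>: "exponent_sequence \<alpha>"
  show "(Lambda1 \<alpha> :: (nat \<Rightarrow> 'k) set) \<subseteq> Lambda1 growth"
    if "(Lambda1 \<alpha> :: (nat \<Rightarrow> 'k) set) \<subseteq> subexponential growth"
  proof -
    have "0 \<le> growth n" for n using growth_ge_1[of n] by linarith
    then show ?thesis using that subexponential_eq_Lambda1[OF summable_exp_growth] by blast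
  qed
  show "(Lambda_inf_dual growth :: (nat \<Rightarrow> 'k) set) \<subseteq> Lambda_inf_dual \<alpha>"
    if "(subexponential growth :: (nat \<Rightarrow> 'k) set) \<subseteq> Lambda_inf_dual \<alpha>"
    using exponent_sequence_growth \<alpha> that by (rule subexponential_subset_Lambda_inf_dual)
qed simp

theorem theorem4p8:
  shows "\<exists>(E :: (nat \<Rightarrow> 'k::{real_normed_field, euclidean_space}) set)
            (nrm :: nat \<Rightarrow> (nat \<Rightarrow> 'k) \<Rightarrow> real).
           frechet_space seq_scale E nrm \<and>
           nuclear_space seq_scale E nrm \<and>
           DN_property E nrm \<and>
           Omega_property seq_scale E nrm \<and>
           (\<exists>\<epsilon>. associated_exponent_sequence seq_scale E nrm \<epsilon> \<and>
                diametral_dimension seq_scale E nrm =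
                  diametral_dimension seq_scale (Lambda1 \<epsilon>) (Lambda1_norm \<epsilon>)) \<and>
           (\<nexists>B. prominent_bounded_set seq_scale E nrm B)"
proof (intro exI conjI)
  show "frechet_space seq_scale (koethe_space weight :: (nat \<Rightarrow> 'k) set) (koethe_norm weight)"
    by (rule example.koethe_frechet)
  show "nuclear_space seq_scale (koethe_space weight :: (nat \<Rightarrow> 'k) set) (koethe_norm weight)"
    by (rule example_nuclear)
  show "DN_property (koethe_space weight :: (nat \<Rightarrow> 'k) set) (koethe_norm weight)"
    by (rule example_DN)
  show "Omega_property seq_scale (koethe_space weight :: (nat \<Rightarrow> 'k) set) (koethe_norm weight)"
    by (rule example_Omega)
  show "associated_exponent_sequence seq_scale (koethe_space weight :: (nat \<Rightarrow> 'k) set) (koethe_norm weight) growth"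
    by (rule example_associated_exponent_sequence)
  show "diametral_dimension seq_scale (koethe_space weight :: (nat \<Rightarrow> 'k) set) (koethe_norm weight)
      = diametral_dimension seq_scale (Lambda1 growth) (Lambda1_norm growth)"
    unfolding example_diametral_dimension diametral_dimension_Lambda1[OF exponent_sequence_growth] ..
  show "\<nexists>B. prominent_bounded_set seq_scale (koethe_space weight :: (nat \<Rightarrow> 'k) set) (koethe_norm weight) B"
    using example_no_prominent_bounded_set by blast
qed

end
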